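(* The lattice $\Lambda(\mathsf{GNPcL})$ of subvarieties of $\mathsf{GNPcL}$ is a chain of order type $\omega+1$, whose proper nontrivial subvarieties are exactly $\mathbf V(\mathbf K_{n^2})$ and $\mathbf V(\mathbf K_{n^2-1})$ for $n\ge2$. Moreover, for $u,v\in\{n^2,\,n^2-1:n\ge2\}$, $\mathbf V(\mathbf K_u)\subseteq\mathbf V(\mathbf K_v)$ if and only if $u\le v$ in $\mathbb N$.
   Context: A commutative residuated lattice is $\langle A,\vee,\wedge,\cdot,\to,1\rangle$ where $\langle A,\vee,\wedge\rangle$ is a lattice, $\langle A,\cdot,1\rangle$ is a commutative monoid and $ab\le c$ iff $a\le b\to c$. It is integral if $1$ is the top element. $\mathsf{CIRL}$ is the variety of commutative integral residuated lattices. Put $\sim x:=x\to 1$. A K-lattice is a commutative residuated lattice that is $1$-involutive ($(x\to1)\to1= x$), $1$-distributive (both lattice distributive laws hold whenever at least one of the elements involved equals $1$) and satisfies (K1) $xy\wedge 1= (x\wedge1)(y\wedge1)$ and (K2) $((x\wedge1)\to y)\wedge((\sim y\wedge1)\to\sim x)= x\to y$. $\mathsf{NPcL}$ is the variety of K-lattices whose lattice reduct is distributive and that satisfy $(x\wedge1)^2= x\wedge1$. $\mathsf{GNPcL}$ is the subvariety of $\mathsf{NPcL}$ axiomatized by $(((x\wedge1)\to y)\vee((y\wedge1)\to x))\wedge1= 1$. For $\mathbf A\in\mathsf{CIRL}$, the K-lattice $K(\mathbf A)$ has universe $A\times A$, unit $(1,1)$ and operations $(a,b)\vee(c,d)=(a\vee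 c,b\wedge d)$, $(a,b)\wedge(c,d)=(a\wedge c,b\vee d)$, $(a,b)(c,d)=(ac,(a\to d)\wedge(c\to b))$, $(a,b)\to(c,d)=((a\to c)\wedge(d\to b),ad)$. $\mathbf G_n$ is the $n$-element chain with $xy=x\wedge y$, $x\to y=1$ if $x\le y$ and $x\to y=y$ otherwise; its bottom is $0$. $\mathbf K_{n^2}=K(\mathbf G_n)$ and $\mathbf K_{n^2-1}$ is the subalgebra of $\mathbf K_{n^2}$ with universe $G_n\times G_n\setminus\{(0,0)\}$. $\mathbf V(\cdot)$ denotes the generated variety. *)

theory Defs
  imports
    "HOL-Algebra.Group"
    "HOL-Library.Extended_Nat"
    "HOL-Library.Discrete_Functions"
begin

section \<open>Algebras in the signature of commutative residuated lattices\<close>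

record 'a rl_alg = "'a monoid" +
  rl_join :: "['a, 'a] \<Rightarrow> 'a" (infixl \<open>\<curlyvee>\<index>\<close> 65)
  rl_meet :: "['a, 'a] \<Rightarrow> 'a" (infixl \<open>\<curlywedge>\<index>\<close> 70)
  rl_imp  :: "['a, 'a] \<Rightarrow> 'a" (infixr \<open>\<leadsto>\<index>\<close> 60)

definition rl_le :: "'a rl_alg \<Rightarrow> 'a \<Rightarrow> 'a \<Rightarrow> bool" (infix \<open>\<preceq>\<index>\<close> 50)
  where "x \<preceq>\<^bsub>A\<^esub> y \<longleftrightarrow> x \<curlywedge>\<^bsub>A\<^esub> y = x"

definition rl_neg :: "'a rl_alg \<Rightarrow> 'a \<Rightarrow> 'a" (\<open>\<sim>\<index> _\<close> [81] 80)
  where "\<sim>\<^bsub>A\<^esub> x = x \<leadsto>\<^bsub>A\<^esub> \<one>\<^bsub>A\<^esub>"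

text \<open>The operations may take arbitrary values outside the carrier; only the carrier matters in
  everything below. Algebras are nonempty because of the constant \<open>\<one>\<close>.\<close>

locale rl_algebra =
  fixes A :: "'a rl_alg" (structure)
  assumes one_in: "\<one> \<in> carrier A"
    and mult_in: "\<lbrakk>x \<in> carrier A; y \<in> carrier A\<rbrakk> \<Longrightarrow> x \<otimes> y \<in> carrier A"
    and join_in: "\<lbrakk>x \<in> carrier A; y \<in> carrier A\<rbrakk> \<Longrightarrow> x \<curlyvee> y \<in> carrier A"
    and meet_in: "\<lbrakk>x \<in> carrier A; y \<in> carrier A\<rbrakk> \<Longrightarrow> x \<curlywedge> y \<in> carrier A"
    and imp_in: "\<lbrakk>x \<in> carrier A; y \<in> carrier A\<rbrakk> \<Longrightarrow> x \<leadsto> y \<in> carrier A"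

locale crl = rl_algebra A + comm_monoid A for A :: "'a rl_alg" (structure) +
  assumes join_comm: "\<lbrakk>x \<in> carrier A; y \<in> carrier A\<rbrakk> \<Longrightarrow> x \<curlyvee> y = y \<curlyvee> x"
    and meet_comm: "\<lbrakk>x \<in> carrier A; y \<in> carrier A\<rbrakk> \<Longrightarrow> x \<curlywedge> y = y \<curlywedge> x"
    and join_assoc: "\<lbrakk>x \<in> carrier A; y \<in> carrier A; z \<in> carrier A\<rbrakk>
          \<Longrightarrow> (x \<curlyvee> y) \<curlyvee> z = x \<curlyvee> (y \<curlyvee> z)"
    and meet_assoc: "\<lbrakk>x \<in> carrier A; y \<in> carrier A; z \<in> carrier A\<rbrakk>
          \<Longrightarrow> (x \<curlywedge> y) \<curlywedge> z = x \<curlywedge> (y \<curlywedge> z)"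
    and join_absorb: "\<lbrakk>x \<in> carrier A; y \<in> carrier A\<rbrakk> \<Longrightarrow> x \<curlyvee> (x \<curlywedge> y) = x"
    and meet_absorb: "\<lbrakk>x \<in> carrier A; y \<in> carrier A\<rbrakk> \<Longrightarrow> x \<curlywedge> (x \<curlyvee> y) = x"
    and residuation: "\<lbrakk>x \<in> carrier A; y \<in> carrier A; z \<in> carrier A\<rbrakk>
          \<Longrightarrow> x \<otimes> y \<preceq> z \<longleftrightarrow> x \<preceq> y \<leadsto> z"

locale K_lattice = crl +
  assumes one_involutive: "x \<in> carrier A \<Longrightarrow> (x \<leadsto> \<one>) \<leadsto> \<one> = x"
    and one_distrib_meet: "\<lbrakk>x \<in> carrier A; y \<in> carrier A; z \<in> carrier A; \<one> \<in> {x, y, z}\<rbrakk>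
          \<Longrightarrow> x \<curlywedge> (y \<curlyvee> z) = (x \<curlywedge> y) \<curlyvee> (x \<curlywedge> z)"
    and one_distrib_join: "\<lbrakk>x \<in> carrier A; y \<in> carrier A; z \<in> carrier A; \<one> \<in> {x, y, z}\<rbrakk>
          \<Longrightarrow> x \<curlyvee> (y \<curlywedge> z) = (x \<curlyvee> y) \<curlywedge> (x \<curlyvee> z)"
    and K1: "\<lbrakk>x \<in> carrier A; y \<in> carrier A\<rbrakk>
          \<Longrightarrow> (x \<otimes> y) \<curlywedge> \<one> = (x \<curlywedge> \<one>) \<otimes> (y \<curlywedge> \<one>)"
    and K2: "\<lbrakk>x \<in> carrier A; y \<in> carrier A\<rbrakk>
          \<Longrightarrow> ((x \<curlywedge> \<one>) \<leadsto> y) \<curlywedge> ((\<sim>y \<curlywedge> \<one>) \<leadsto> \<sim>x) = x \<leadsto> y"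

locale npcl = K_lattice +
  assumes distrib_meet: "\<lbrakk>x \<in> carrier A; y \<in> carrier A; z \<in> carrier A\<rbrakk>
          \<Longrightarrow> x \<curlywedge> (y \<curlyvee> z) = (x \<curlywedge> y) \<curlyvee> (x \<curlywedge> z)"
    and distrib_join: "\<lbrakk>x \<in> carrier A; y \<in> carrier A; z \<in> carrier A\<rbrakk>
          \<Longrightarrow> x \<curlyvee> (y \<curlywedge> z) = (x \<curlyvee> y) \<curlywedge> (x \<curlyvee> z)"
    and neg_cone_idem: "x \<in> carrier A \<Longrightarrow> (x \<curlywedge> \<one>) \<otimes> (x \<curlywedge> \<one>) = x \<curlywedge> \<one>"

locale gnpcl = npcl +
  assumes godel: "\<lbrakk>x \<in> carrier A; y \<in> carrier A\<rbrakk>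
          \<Longrightarrow> (((x \<curlywedge> \<one>) \<leadsto> y) \<curlyvee> ((y \<curlywedge> \<one>) \<leadsto> x)) \<curlywedge> \<one> = \<one>"

definition GNPcL :: "'a rl_alg set"
  where "GNPcL = {A. gnpcl A}"


section \<open>Varieties\<close>

datatype rl_term =
    RVar nat
  | ROne
  | RMult rl_term rl_term
  | RJoin rl_term rl_term
  | RMeet rl_term rl_term
  | RImp rl_term rl_term

fun rl_eval :: "'a rl_alg \<Rightarrow> (nat \<Rightarrow> 'a) \<Rightarrow> rl_term \<Rightarrow> 'a" where
  "rl_eval A v (RVar i) = v i"
| "rl_eval A v ROne = \<one>\<^bsub>A\<^esub>"
| "rl_eval A v (RMult s t) = rl_eval A v s \<otimes>\<^bsub>A\<^esub> rl_eval A v t"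
| "rl_eval A v (RJoin s t) = rl_eval A v s \<curlyvee>\<^bsub>A\<^esub> rl_eval A v t"
| "rl_eval A v (RMeet s t) = rl_eval A v s \<curlywedge>\<^bsub>A\<^esub> rl_eval A v t"
| "rl_eval A v (RImp s t) = rl_eval A v s \<leadsto>\<^bsub>A\<^esub> rl_eval A v t"

definition satisfies :: "'a rl_alg \<Rightarrow> rl_term \<times> rl_term \<Rightarrow> bool" where
  "satisfies A e \<longleftrightarrow>
    (\<forall>v. (\<forall>i. v i \<in> carrier A) \<longrightarrow> rl_eval A v (fst e) = rl_eval A v (snd e))"

text \<open>Classes of algebras are represented by their members whose carrier is a subset of a given
  type \<open>'a\<close>. As the signature is finite, an infinite \<open>'a\<close> has room for the free algebra on
  countably many generators of each variety, so different varieties have different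
  representations.\<close>

definition Models :: "(rl_term \<times> rl_term) set \<Rightarrow> 'a rl_alg set"
  where "Models E = {A. rl_algebra A \<and> (\<forall>e\<in>E. satisfies A e)}"

definition is_variety :: "'a rl_alg set \<Rightarrow> bool"
  where "is_variety V \<longleftrightarrow> (\<exists>E. V = Models E)"

text \<open>The smallest variety containing \<open>B\<close>. The generator \<open>B\<close> need not live on the type \<open>'a\<close> that
  carries the members of the variety, so "\<open>B\<close> is a member" is expressed by the models of \<open>E\<close> over
  the type of \<open>B\<close>.\<close>

definition generated_variety :: "'b rl_alg \<Rightarrow> 'a rl_alg set"
  where "generated_variety B = \<Inter> {Models E | E. B \<in> Models E}"

definition nontrivial_variety :: "'a rl_alg set \<Rightarrow> bool"
  where "nontrivial_variety V \<longleftrightarrow> (\<exists>A\<in>V. \<exists>x\<in>carrier A. \<exists>y\<in>carrier A. x \<noteq> y)"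

definition subvarieties :: "'a rl_alg set \<Rightarrow> 'a rl_alg set set"
  where "subvarieties V = {W. is_variety W \<and> W \<subseteq> V}"


section \<open>The generating algebras\<close>

definition K_construction :: "'a rl_alg \<Rightarrow> ('a \<times> 'a) rl_alg" where
  "K_construction A = \<lparr>
     carrier = carrier A \<times> carrier A,
     mult = (\<lambda>(a, b) (c, d). (a \<otimes>\<^bsub>A\<^esub> c, (a \<leadsto>\<^bsub>A\<^esub> d) \<curlywedge>\<^bsub>A\<^esub> (c \<leadsto>\<^bsub>A\<^esub> b))),
     one = (\<one>\<^bsub>A\<^esub>, \<one>\<^bsub>A\<^esub>),
     rl_join = (\<lambda>(a, b) (c, d). (a \<curlyvee>\<^bsub>A\<^esub> c, b \<curlywedge>\<^bsub>A\<^esub> d)),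
     rl_meet = (\<lambda>(a, b) (c, d). (a \<curlywedge>\<^bsub>A\<^esub> c, b \<curlyvee>\<^bsub>A\<^esub> d)),
     rl_imp = (\<lambda>(a, b) (c, d). ((a \<leadsto>\<^bsub>A\<^esub> c) \<curlywedge>\<^bsub>A\<^esub> (d \<leadsto>\<^bsub>A\<^esub> b), a \<otimes>\<^bsub>A\<^esub> d)) \<rparr>"

text \<open>The \<open>n\<close>-element chain is \<open>0 < 1 < \<dots> < n - 1\<close> (for \<open>n \<ge> 1\<close>); its unit and top is the number
  \<open>n - 1\<close>.\<close>

definition Godel_chain :: "nat \<Rightarrow> nat rl_alg" where
  "Godel_chain n = \<lparr>
     carrier = {..<n},
     mult = min,
     one = n - 1,
     rl_join = max,
     rl_meet = min,
     rl_imp = (\<lambda>x y. if x \<le> y then n - 1 else y) \<rparr>"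

definition K_full :: "nat \<Rightarrow> (nat \<times> nat) rl_alg"
  where "K_full n = K_construction (Godel_chain n)"

definition K_punctured :: "nat \<Rightarrow> (nat \<times> nat) rl_alg"
  where "K_punctured n = (K_full n)\<lparr>carrier := carrier (K_full n) - {(0, 0)}\<rparr>"

definition K_indices :: "nat set"
  where "K_indices = {n\<^sup>2 | n. n \<ge> 2} \<union> {n\<^sup>2 - 1 | n. n \<ge> 2}"

text \<open>The algebra with index \<open>u\<close>; for \<open>u = n\<^sup>2\<close> and for \<open>u = n\<^sup>2 - 1\<close>, with \<open>n \<ge> 2\<close>, the number
  \<open>floor_sqrt (u + 1)\<close> is \<open>n\<close>.\<close>

definition K_alg :: "nat \<Rightarrow> (nat \<times> nat) rl_alg" where
  "K_alg u = (let n = floor_sqrt (u + 1) in if u = n\<^sup>2 then K_full n else K_punctured n)"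

lemma K_alg_square: "n \<ge> 2 \<Longrightarrow> K_alg (n\<^sup>2) = K_full n"
proof -
  assume "n \<ge> 2"
  then have "floor_sqrt (n\<^sup>2 + 1) = n"
    by (intro floor_sqrt_unique) (auto simp: power2_eq_square)
  then show ?thesis by (simp add: K_alg_def)
qed

lemma K_alg_square_minus_1: "n \<ge> 2 \<Longrightarrow> K_alg (n\<^sup>2 - 1) = K_punctured n"
proof -
  assume "n \<ge> 2"
  then have "n\<^sup>2 > 0" by simp
  then have "n\<^sup>2 - 1 + 1 = n\<^sup>2" "n\<^sup>2 - 1 \<noteq> n\<^sup>2" by linarith+
  then show ?thesis by (simp add: K_alg_def Let_def del: One_nat_def)
qed

end

(* For a K-lattice A in GNPcL with negative cone N, the map x |-> (x /\ 1, ~x /\ 1) embeds A into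
   K(N), where N is a prelinear Brouwerian algebra. If an identity fails in A, finitely many elements
   of N are involved; prelinearity yields an f in N such that d |-> f /\ d collapses them to a finite
   chain, on which the residual is that of a Goedel chain, without identifying the two sides of the
   identity. A subalgebra of K(G_n) containing the whole negative cone is K(G_n) or K(G_n) - {(0,0)},
   so every identity that fails in A fails in some K_u that satisfies all identities of A. As the K_u
   form a chain, separated by identities that bound the number of elements, a subvariety is determined
   by an initial segment of the indices u. *)

theory Submission
  imports Defs
begin

section \<open>Equational theories and homomorphisms\<close>

text \<open>Membership in a variety is tested one identity at a time, so only the finite set
  \<open>D\<close> of coordinates of the values of its variables enters. The obstacle is that
  \<open>D\<close> need not be closed under the residual of the cone. Call \<open>x\<close> and
  \<open>y\<close> equal modulo \<open>f\<close> if their meets with \<open>f\<close> agree. If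
  \<open>f\<close> compares the elements of \<open>D\<close> and their residuals with one another,
  then modulo \<open>f\<close> each residual is the unit or its second argument, so nothing new
  arises. Thus \<open>f\<close> stands for the filter above it, which looks prime as far as finitely
  many elements can tell. It must avoid the residual \<open>w\<close> of two coordinates that tell
  the sides of the identity apart.

  The top of the order type omega+1 is GNPcL itself: as every failing identity already fails in a
  finite generator, a subvariety that contains all generators is everything.\<close>

definition equational_theory :: "'a rl_alg \<Rightarrow> (rl_term \<times> rl_term) set"
  where "equational_theory A = {e. satisfies A e}"

lemma rl_eval_in_carrier:
  assumes "rl_algebra A" "\<And>i. v i \<in> carrier A"
  shows "rl_eval A v t \<in> carrier A"
proof -
  interpret rl_algebra A by fact
  show ?thesis
    by (induction t) (simp_all add: assms(2) one_in mult_in join_in meet_in imp_in)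
qed

text \<open>The domain is a subuniverse \<open>S\<close> of \<open>A\<close>, because the collapse
  onto a finite chain is defined only for elements whose coordinates fall into that chain. That
  \<open>h\<close> maps into the carrier of \<open>B\<close> is stated separately where it
  matters.\<close>

definition hom_on :: "'a set \<Rightarrow> 'a rl_alg \<Rightarrow> 'b rl_alg \<Rightarrow> ('a \<Rightarrow> 'b) \<Rightarrow> bool"
  where "hom_on S A B h \<longleftrightarrow> S \<subseteq> carrier A \<and> \<one>\<^bsub>A\<^esub> \<in> S \<and> h \<one>\<^bsub>A\<^esub> = \<one>\<^bsub>B\<^esub> \<and>
    (\<forall>x\<in>S. \<forall>y\<in>S.
      x \<otimes>\<^bsub>A\<^esub> y \<in> S \<and> h (x \<otimes>\<^bsub>A\<^esub> y) = h x \<otimes>\<^bsub>B\<^esub> h y \<and>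
      x \<curlyvee>\<^bsub>A\<^esub> y \<in> S \<and> h (x \<curlyvee>\<^bsub>A\<^esub> y) = h x \<curlyvee>\<^bsub>B\<^esub> h y \<and>
      x \<curlywedge>\<^bsub>A\<^esub> y \<in> S \<and> h (x \<curlywedge>\<^bsub>A\<^esub> y) = h x \<curlywedge>\<^bsub>B\<^esub> h y \<and>
      x \<leadsto>\<^bsub>A\<^esub> y \<in> S \<and> h (x \<leadsto>\<^bsub>A\<^esub> y) = h x \<leadsto>\<^bsub>B\<^esub> h y)"

lemma hom_on_eval:
  assumes "hom_on S A B h" "\<forall>i. v i \<in> S"
  shows "rl_eval A v t \<in> S \<and> h (rl_eval A v t) = rl_eval B (\<lambda>i. h (v i)) t"
  using assms by (induction t) (simp_all add: hom_on_def)

text \<open>A valuation in \<open>B\<close> lifts along \<open>h\<close> to one in \<open>S\<close>: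
  identities pass to homomorphic images of subalgebras.\<close>

lemma equational_theory_image:
  assumes h: "hom_on S A B h" and B: "carrier B \<subseteq> h ` S"
  shows "equational_theory A \<subseteq> equational_theory B"
proof
  fix e assume e: "e \<in> equational_theory A"
  have "rl_eval B v (fst e) = rl_eval B v (snd e)" if v: "\<forall>i. v i \<in> carrier B" for v
  proof -
    have "\<forall>i. \<exists>x\<in>S. v i = h x" using v B by blast
    then obtain w where w: "\<forall>i. w i \<in> S" "\<And>i. v i = h (w i)" by metis
    have "\<forall>i. w i \<in> carrier A" using w(1) h by (auto simp: hom_on_def)
    then have "rl_eval A w (fst e) = rl_eval A w (snd e)"
      using e by (simp add: equational_theory_def satisfies_def)
    moreover have "v = (\<lambda>i. h (w i))" using w(2) by auto
    ultimately show ?thesis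
      using hom_on_eval[OF h w(1), where t = "fst e"] hom_on_eval[OF h w(1), where t = "snd e"] by simp
  qed
  then show "e \<in> equational_theory B" by (simp add: equational_theory_def satisfies_def)
qed

lemma equational_theory_embedding:
  assumes h: "hom_on (carrier B) B A h" and inj: "inj_on h (carrier B)"
    and A: "h ` carrier B \<subseteq> carrier A"
  shows "equational_theory A \<subseteq> equational_theory B"
proof
  fix e assume e: "e \<in> equational_theory A"
  have "rl_eval B v (fst e) = rl_eval B v (snd e)" if v: "\<forall>i. v i \<in> carrier B" for v
  proof -
    note ev = hom_on_eval[OF h v, where t = "fst e"] hom_on_eval[OF h v, where t = "snd e"]
    have "\<forall>i. h (v i) \<in> carrier A" using v A by blast
    then have "rl_eval A (\<lambda>i. h (v i)) (fst e) = rl_eval A (\<lambda>i. h (v i)) (snd e)"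
      using e by (simp add: equational_theory_def satisfies_def)
    then have "h (rl_eval B v (fst e)) = h (rl_eval B v (snd e))"
      using ev by simp
    then show ?thesis using inj ev by (blast dest: inj_onD)
  qed
  then show "e \<in> equational_theory B" by (simp add: equational_theory_def satisfies_def)
qed

text \<open>Moves a generator, which lives on pairs of numbers, to the arbitrary type that carries
  the members of the varieties.\<close>

definition copy_alg :: "('b \<Rightarrow> 'a) \<Rightarrow> 'b rl_alg \<Rightarrow> 'a rl_alg" where
  "copy_alg f B = (let g = inv_into (carrier B) f in \<lparr>
     carrier = f ` carrier B,
     mult = (\<lambda>x y. f (g x \<otimes>\<^bsub>B\<^esub> g y)),
     one = f \<one>\<^bsub>B\<^esub>,
     rl_join = (\<lambda>x y. f (g x \<curlyvee>\<^bsub>B\<^esub> g y)),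
     rl_meet = (\<lambda>x y. f (g x \<curlywedge>\<^bsub>B\<^esub> g y)),
     rl_imp = (\<lambda>x y. f (g x \<leadsto>\<^bsub>B\<^esub> g y)) \<rparr>)"

lemma copy_alg:
  assumes "rl_algebra B" and inj: "inj_on f (carrier B)"
  shows rl_algebra_copy: "rl_algebra (copy_alg f B)"
    and equational_theory_copy: "equational_theory (copy_alg f B) = equational_theory B"
    and carrier_copy: "carrier (copy_alg f B) = f ` carrier B"
proof -
  interpret rl_algebra B by fact
  show c: "carrier (copy_alg f B) = f ` carrier B" by (simp add: copy_alg_def Let_def)
  show "rl_algebra (copy_alg f B)"
    by unfold_locales
      (auto simp: copy_alg_def Let_def inv_into_f_f[OF inj] one_in mult_in join_in meet_in imp_in)
  have "hom_on (carrier B) B (copy_alg f B) f"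
    by (simp add: hom_on_def copy_alg_def Let_def inv_into_f_f[OF inj] one_in mult_in join_in
        meet_in imp_in)
  then show "equational_theory (copy_alg f B) = equational_theory B"
    using equational_theory_embedding equational_theory_image inj c by blast
qed

lemma Models_iff:
  "A \<in> Models E \<longleftrightarrow> rl_algebra A \<and> E \<subseteq> equational_theory A"
  by (auto simp: Models_def equational_theory_def)

text \<open>The theory of \<open>B\<close> is the largest set of identities with \<open>B\<close> as
  a model, so its models form the least class in the intersection.\<close>

lemma generated_variety_eq:
  fixes B :: "'b rl_alg"
  assumes "rl_algebra B"
  shows "(generated_variety B :: 'a rl_alg set) = Models (equational_theory B)"
proof (rule equalityI)
  have "B \<in> Models (equational_theory B)" using assms by (simp add: Models_iff)
  then show "generated_variety B \<subseteq> Models (equational_theory B)"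
    unfolding generated_variety_def by (intro Inter_lower) blast
  have "Models (equational_theory B) \<subseteq> (Models E :: 'a rl_alg set)" if "B \<in> Models E" for E
    using that unfolding Models_def equational_theory_def by blast
  then show "Models (equational_theory B) \<subseteq> (generated_variety B :: 'a rl_alg set)"
    unfolding generated_variety_def by (intro Inter_greatest) (elim CollectE exE conjE, simp)
qed


section \<open>An equational basis of GNPcL\<close>

text \<open>Residuation is an equivalence of inequalities. Four identities express it:
  multiplication preserves joins, the residual preserves meets in its second argument, and the unit
  \<open>x \<le> y \<leadsto> xy\<close> and counit \<open>(y \<leadsto> z)y \<le> z\<close> of the
  adjunction hold.\<close>

definition GNPcL_basis :: "(rl_term \<times> rl_term) set" where
  "GNPcL_basis = (let x = RVar 0; y = RVar (Suc 0); z = RVar (Suc (Suc 0)) in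
    {(RMult (RMult x y) z, RMult x (RMult y z)),
     (RMult x y, RMult y x),
     (RMult ROne x, x),
     (RJoin x y, RJoin y x),
     (RMeet x y, RMeet y x),
     (RJoin (RJoin x y) z, RJoin x (RJoin y z)),
     (RMeet (RMeet x y) z, RMeet x (RMeet y z)),
     (RJoin x (RMeet x y), x),
     (RMeet x (RJoin x y), x),
     (RMult x (RJoin y z), RJoin (RMult x y) (RMult x z)),
     (RImp x (RMeet y z), RMeet (RImp x y) (RImp x z)),
     (RMeet x (RImp y (RMult x y)), x),
     (RMeet (RMult (RImp y z) y) z, RMult (RImp y z) y),
     (RImp (RImp x ROne) ROne, x),
     (RMeet (RMult x y) ROne, RMult (RMeet x ROne) (RMeet y ROne)),
     (RMeet (RImp (RMeet x ROne) y) (RImp (RMeet (RImp y ROne) ROne) (RImp x ROne)), RImp x y),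
     (RMeet x (RJoin y z), RJoin (RMeet x y) (RMeet x z)),
     (RJoin x (RMeet y z), RMeet (RJoin x y) (RJoin x z)),
     (RMult (RMeet x ROne) (RMeet x ROne), RMeet x ROne),
     (RMeet (RJoin (RImp (RMeet x ROne) y) (RImp (RMeet y ROne) x)) ROne, ROne)})"

text \<open>Variables 0 and 1 receive \<open>x\<close> and \<open>y\<close>, all others
  \<open>z\<close>, so the valuation is total and stays in the carrier.\<close>

lemma satisfies_three:
  assumes "satisfies A e" "x \<in> carrier A" "y \<in> carrier A" "z \<in> carrier A"
  shows "rl_eval A (case_nat x (case_nat y (\<lambda>_. z))) (fst e)
       = rl_eval A (case_nat x (case_nat y (\<lambda>_. z))) (snd e)"
  using assms by (auto simp: satisfies_def split: nat.split)

text \<open>Residuation is recovered as an adjunction: preservation of meets and joins makes the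
  residual and the product monotone, and composing with the unit and the counit gives the two
  directions.\<close>

lemma Models_basis_gnpcl:
  assumes "A \<in> Models GNPcL_basis"
  shows "gnpcl A"
proof -
  interpret rl_algebra A using assms by (simp add: Models_def)
  have sat: "\<forall>e\<in>GNPcL_basis. satisfies A e"
    using assms by (simp add: Models_def)
  have "\<forall>x\<in>carrier A. \<forall>y\<in>carrier A. \<forall>z\<in>carrier A. \<forall>e\<in>GNPcL_basis.
      rl_eval A (case_nat x (case_nat y (\<lambda>_. z))) (fst e)
       = rl_eval A (case_nat x (case_nat y (\<lambda>_. z))) (snd e)"
    by (intro ballI satisfies_three sat[rule_format])
  note ax = this[unfolded GNPcL_basis_def Let_def, unfolded ball_simps(7),
      unfolded fst_conv snd_conv, unfolded rl_eval.simps, unfolded nat.case, rule_format]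
  note cl = one_in mult_in join_in meet_in imp_in
  have mult_assoc: "(x \<otimes>\<^bsub>A\<^esub> y) \<otimes>\<^bsub>A\<^esub> z = x \<otimes>\<^bsub>A\<^esub> (y \<otimes>\<^bsub>A\<^esub> z)"
    and join_assoc: "(x \<curlyvee>\<^bsub>A\<^esub> y) \<curlyvee>\<^bsub>A\<^esub> z = x \<curlyvee>\<^bsub>A\<^esub> (y \<curlyvee>\<^bsub>A\<^esub> z)"
    and meet_assoc: "(x \<curlywedge>\<^bsub>A\<^esub> y) \<curlywedge>\<^bsub>A\<^esub> z = x \<curlywedge>\<^bsub>A\<^esub> (y \<curlywedge>\<^bsub>A\<^esub> z)"
    and mult_join: "x \<otimes>\<^bsub>A\<^esub> (y \<curlyvee>\<^bsub>A\<^esub> z) = x \<otimes>\<^bsub>A\<^esub> y \<curlyvee>\<^bsub>A\<^esub> x \<otimes>\<^bsub>A\<^esub> z"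
    and imp_meet: "x \<leadsto>\<^bsub>A\<^esub> y \<curlywedge>\<^bsub>A\<^esub> z = (x \<leadsto>\<^bsub>A\<^esub> y) \<curlywedge>\<^bsub>A\<^esub> (x \<leadsto>\<^bsub>A\<^esub> z)"
    and distrib1: "x \<curlywedge>\<^bsub>A\<^esub> (y \<curlyvee>\<^bsub>A\<^esub> z) = (x \<curlywedge>\<^bsub>A\<^esub> y) \<curlyvee>\<^bsub>A\<^esub> (x \<curlywedge>\<^bsub>A\<^esub> z)"
    and distrib2: "x \<curlyvee>\<^bsub>A\<^esub> (y \<curlywedge>\<^bsub>A\<^esub> z) = (x \<curlyvee>\<^bsub>A\<^esub> y) \<curlywedge>\<^bsub>A\<^esub> (x \<curlyvee>\<^bsub>A\<^esub> z)"
    if "x \<in> carrier A" "y \<in> carrier A" "z \<in> carrier A" for x y z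
    using ax[OF that] by - (elim conjE, assumption)+
  have mult_comm: "x \<otimes>\<^bsub>A\<^esub> y = y \<otimes>\<^bsub>A\<^esub> x"
    and join_comm: "x \<curlyvee>\<^bsub>A\<^esub> y = y \<curlyvee>\<^bsub>A\<^esub> x"
    and meet_comm: "x \<curlywedge>\<^bsub>A\<^esub> y = y \<curlywedge>\<^bsub>A\<^esub> x"
    and join_absorb: "x \<curlyvee>\<^bsub>A\<^esub> x \<curlywedge>\<^bsub>A\<^esub> y = x"
    and meet_absorb: "x \<curlywedge>\<^bsub>A\<^esub> (x \<curlyvee>\<^bsub>A\<^esub> y) = x"
    and unit: "x \<curlywedge>\<^bsub>A\<^esub> (y \<leadsto>\<^bsub>A\<^esub> x \<otimes>\<^bsub>A\<^esub> y) = x"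
    and counit: "((y \<leadsto>\<^bsub>A\<^esub> x) \<otimes>\<^bsub>A\<^esub> y) \<curlywedge>\<^bsub>A\<^esub> x = (y \<leadsto>\<^bsub>A\<^esub> x) \<otimes>\<^bsub>A\<^esub> y"
    and K1: "(x \<otimes>\<^bsub>A\<^esub> y) \<curlywedge>\<^bsub>A\<^esub> \<one>\<^bsub>A\<^esub> = (x \<curlywedge>\<^bsub>A\<^esub> \<one>\<^bsub>A\<^esub>) \<otimes>\<^bsub>A\<^esub> (y \<curlywedge>\<^bsub>A\<^esub> \<one>\<^bsub>A\<^esub>)"
    and K2: "(x \<curlywedge>\<^bsub>A\<^esub> \<one>\<^bsub>A\<^esub> \<leadsto>\<^bsub>A\<^esub> y) \<curlywedge>\<^bsub>A\<^esub> ((y \<leadsto>\<^bsub>A\<^esub> \<one>\<^bsub>A\<^esub>) \<curlywedge>\<^bsub>A\<^esub> \<one>\<^bsub>A\<^esub> \<leadsto>\<^bsub>A\<^esub> (x \<leadsto>\<^bsub>A\<^esub> \<one>\<^bsub>A\<^esub>))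
          = x \<leadsto>\<^bsub>A\<^esub> y"
    and godel: "((x \<curlywedge>\<^bsub>A\<^esub> \<one>\<^bsub>A\<^esub> \<leadsto>\<^bsub>A\<^esub> y) \<curlyvee>\<^bsub>A\<^esub> (y \<curlywedge>\<^bsub>A\<^esub> \<one>\<^bsub>A\<^esub> \<leadsto>\<^bsub>A\<^esub> x)) \<curlywedge>\<^bsub>A\<^esub> \<one>\<^bsub>A\<^esub> = \<one>\<^bsub>A\<^esub>"
    if "x \<in> carrier A" "y \<in> carrier A" for x y
    using ax[OF that(1,2,1)] by - (elim conjE, assumption)+
  have unit_left: "\<one>\<^bsub>A\<^esub> \<otimes>\<^bsub>A\<^esub> x = x"
    and involutive: "(x \<leadsto>\<^bsub>A\<^esub> \<one>\<^bsub>A\<^esub>) \<leadsto>\<^bsub>A\<^esub> \<one>\<^bsub>A\<^esub> = x"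
    and idem: "(x \<curlywedge>\<^bsub>A\<^esub> \<one>\<^bsub>A\<^esub>) \<otimes>\<^bsub>A\<^esub> (x \<curlywedge>\<^bsub>A\<^esub> \<one>\<^bsub>A\<^esub>) = x \<curlywedge>\<^bsub>A\<^esub> \<one>\<^bsub>A\<^esub>"
    if "x \<in> carrier A" for x
    using ax[OF that that that] by - (elim conjE, assumption)+
  have le_trans: "x \<preceq>\<^bsub>A\<^esub> z" if "x \<preceq>\<^bsub>A\<^esub> y" "y \<preceq>\<^bsub>A\<^esub> z"
    "x \<in> carrier A" "y \<in> carrier A" "z \<in> carrier A" for x y z
    using that meet_assoc[of x y z] unfolding rl_le_def by simp
  have join_le: "x \<curlyvee>\<^bsub>A\<^esub> y = y" if "x \<preceq>\<^bsub>A\<^esub> y" "x \<in> carrier A" "y \<in> carrier A" for x y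
    using that join_absorb[of y x] meet_comm[of x y] join_comm[of x y] unfolding rl_le_def by simp
  have le_join: "x \<preceq>\<^bsub>A\<^esub> y" if "x \<curlyvee>\<^bsub>A\<^esub> y = y" "x \<in> carrier A" "y \<in> carrier A" for x y
    using that meet_absorb[of x y] unfolding rl_le_def by simp
  show ?thesis
  proof
    fix x y z assume c: "x \<in> carrier A" "y \<in> carrier A" "z \<in> carrier A"
    show "x \<otimes>\<^bsub>A\<^esub> y \<preceq>\<^bsub>A\<^esub> z \<longleftrightarrow> x \<preceq>\<^bsub>A\<^esub> y \<leadsto>\<^bsub>A\<^esub> z"
    proof
      assume "x \<otimes>\<^bsub>A\<^esub> y \<preceq>\<^bsub>A\<^esub> z"
      then have 1: "y \<leadsto>\<^bsub>A\<^esub> (x \<otimes>\<^bsub>A\<^esub> y) \<preceq>\<^bsub>A\<^esub> y \<leadsto>\<^bsub>A\<^esub> z"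
        using imp_meet[of y "x \<otimes>\<^bsub>A\<^esub> y" z] c cl unfolding rl_le_def by simp
      have 2: "x \<preceq>\<^bsub>A\<^esub> y \<leadsto>\<^bsub>A\<^esub> (x \<otimes>\<^bsub>A\<^esub> y)" using unit c unfolding rl_le_def by simp
      show "x \<preceq>\<^bsub>A\<^esub> y \<leadsto>\<^bsub>A\<^esub> z" by (rule le_trans[OF 2 1]) (simp_all add: c cl)
    next
      assume "x \<preceq>\<^bsub>A\<^esub> y \<leadsto>\<^bsub>A\<^esub> z"
      then have "y \<otimes>\<^bsub>A\<^esub> x \<preceq>\<^bsub>A\<^esub> y \<otimes>\<^bsub>A\<^esub> (y \<leadsto>\<^bsub>A\<^esub> z)"
        using mult_join[of y x "y \<leadsto>\<^bsub>A\<^esub> z"] c cl join_le le_join by simp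
      then have 1: "x \<otimes>\<^bsub>A\<^esub> y \<preceq>\<^bsub>A\<^esub> (y \<leadsto>\<^bsub>A\<^esub> z) \<otimes>\<^bsub>A\<^esub> y"
        using mult_comm[of y x] mult_comm[of y "y \<leadsto>\<^bsub>A\<^esub> z"] c cl by simp
      have 2: "(y \<leadsto>\<^bsub>A\<^esub> z) \<otimes>\<^bsub>A\<^esub> y \<preceq>\<^bsub>A\<^esub> z" using counit c unfolding rl_le_def by simp
      show "x \<otimes>\<^bsub>A\<^esub> y \<preceq>\<^bsub>A\<^esub> z" by (rule le_trans[OF 1 2]) (simp_all add: c cl)
    qed
  next
    fix x assume "x \<in> carrier A"
    then show "x \<otimes>\<^bsub>A\<^esub> \<one>\<^bsub>A\<^esub> = x" using unit_left mult_comm one_in by metis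
  qed (unfold rl_neg_def, (rule cl mult_assoc join_assoc meet_assoc distrib1 distrib2 mult_comm
      join_comm meet_comm join_absorb meet_absorb K1 K2 godel unit_left involutive idem;
      assumption)+)
qed

section \<open>Order and residuation in commutative residuated lattices\<close>

context crl
begin

lemmas closed [simp, intro] = one_in mult_in join_in meet_in imp_in

lemma meet_idem: "x \<in> carrier A \<Longrightarrow> x \<curlywedge> x = x"
  using meet_absorb[of x "x \<curlywedge> x"] join_absorb[of x x] by simp

lemma le_refl [simp]: "x \<in> carrier A \<Longrightarrow> x \<preceq> x"
  by (simp add: rl_le_def meet_idem)

lemma le_antisym: "\<lbrakk>x \<preceq> y; y \<preceq> x; x \<in> carrier A; y \<in> carrier A\<rbrakk> \<Longrightarrow> x = y"
  unfolding rl_le_def using meet_comm[of x y] by simp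

lemma le_trans: "\<lbrakk>x \<preceq> y; y \<preceq> z; x \<in> carrier A; y \<in> carrier A; z \<in> carrier A\<rbrakk> \<Longrightarrow> x \<preceq> z"
  unfolding rl_le_def using meet_assoc[of x y z] by simp

lemma meet_le1 [simp]: "\<lbrakk>x \<in> carrier A; y \<in> carrier A\<rbrakk> \<Longrightarrow> x \<curlywedge> y \<preceq> x"
  unfolding rl_le_def using meet_assoc[of x x y] meet_comm[of "x \<curlywedge> y" x] meet_idem[of x] by simp

lemma meet_le2 [simp]: "\<lbrakk>x \<in> carrier A; y \<in> carrier A\<rbrakk> \<Longrightarrow> x \<curlywedge> y \<preceq> y"
  using meet_le1[of y x] meet_comm[of x y] by simp

lemma le_meet_iff:
  assumes "x \<in> carrier A" "y \<in> carrier A" "z \<in> carrier A"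
  shows "x \<preceq> y \<curlywedge> z \<longleftrightarrow> x \<preceq> y \<and> x \<preceq> z"
proof
  assume "x \<preceq> y \<curlywedge> z"
  then show "x \<preceq> y \<and> x \<preceq> z"
    using le_trans[of x "y \<curlywedge> z" y] le_trans[of x "y \<curlywedge> z" z] assms by simp
next
  assume "x \<preceq> y \<and> x \<preceq> z"
  then show "x \<preceq> y \<curlywedge> z" unfolding rl_le_def using meet_assoc[of x y z] assms by simp
qed

lemma le_iff_join:
  assumes "x \<in> carrier A" "y \<in> carrier A"
  shows "x \<preceq> y \<longleftrightarrow> x \<curlyvee> y = y"
proof
  assume "x \<preceq> y"
  then show "x \<curlyvee> y = y"
    using join_absorb[of y x] meet_comm[of x y] join_comm[of x y] assms unfolding rl_le_def by simp
next
  assume "x \<curlyvee> y = y"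
  then show "x \<preceq> y" using meet_absorb[of x y] assms unfolding rl_le_def by simp
qed

lemma join_ge1 [simp]: "\<lbrakk>x \<in> carrier A; y \<in> carrier A\<rbrakk> \<Longrightarrow> x \<preceq> x \<curlyvee> y"
  by (simp add: rl_le_def meet_absorb)

lemma join_ge2 [simp]: "\<lbrakk>x \<in> carrier A; y \<in> carrier A\<rbrakk> \<Longrightarrow> y \<preceq> x \<curlyvee> y"
  using join_ge1[of y x] join_comm[of x y] by simp

lemma join_le_iff:
  assumes "x \<in> carrier A" "y \<in> carrier A" "z \<in> carrier A"
  shows "x \<curlyvee> y \<preceq> z \<longleftrightarrow> x \<preceq> z \<and> y \<preceq> z"
proof
  assume "x \<curlyvee> y \<preceq> z"
  then show "x \<preceq> z \<and> y \<preceq> z"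
    using le_trans[of x "x \<curlyvee> y" z] le_trans[of y "x \<curlyvee> y" z] assms by simp
next
  assume "x \<preceq> z \<and> y \<preceq> z"
  then show "x \<curlyvee> y \<preceq> z" using join_assoc[of x y z] assms by (simp add: le_iff_join)
qed

text \<open>Indirect equality: meets and residuals are characterised by their lower bounds, so
  identities between them become chains of equivalences.\<close>

lemma eq_by_lower_bounds:
  assumes "x \<in> carrier A" "y \<in> carrier A" "\<And>w. w \<in> carrier A \<Longrightarrow> w \<preceq> x \<longleftrightarrow> w \<preceq> y"
  shows "x = y"
  using assms(3)[of x] assms(3)[of y] assms(1,2) by (intro le_antisym) auto

lemma eq_by_upper_bounds:
  assumes "x \<in> carrier A" "y \<in> carrier A" "\<And>w. w \<in> carrier A \<Longrightarrow> x \<preceq> w \<longleftrightarrow> y \<preceq> w"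
  shows "x = y"
  using assms(3)[of x] assms(3)[of y] assms(1,2) by (intro le_antisym) auto

lemma residuation':
  "\<lbrakk>x \<in> carrier A; y \<in> carrier A; z \<in> carrier A\<rbrakk> \<Longrightarrow> y \<otimes> x \<preceq> z \<longleftrightarrow> x \<preceq> y \<leadsto> z"
  using residuation m_comm by simp

lemma mult_join:
  assumes "x \<in> carrier A" "y \<in> carrier A" "z \<in> carrier A"
  shows "x \<otimes> (y \<curlyvee> z) = (x \<otimes> y) \<curlyvee> (x \<otimes> z)"
  by (rule eq_by_upper_bounds) (use assms in \<open>simp_all add: residuation' join_le_iff\<close>)

lemma imp_meet:
  assumes "x \<in> carrier A" "y \<in> carrier A" "z \<in> carrier A"
  shows "x \<leadsto> (y \<curlywedge> z) = (x \<leadsto> y) \<curlywedge> (x \<leadsto> z)"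
  by (rule eq_by_lower_bounds) (use assms in \<open>simp_all flip: residuation add: le_meet_iff\<close>)

lemma imp_curry:
  assumes "x \<in> carrier A" "y \<in> carrier A" "z \<in> carrier A"
  shows "(x \<otimes> y) \<leadsto> z = x \<leadsto> (y \<leadsto> z)"
  by (rule eq_by_lower_bounds) (use assms in \<open>simp_all flip: residuation add: m_assoc\<close>)

lemma le_imp_mult: "\<lbrakk>x \<in> carrier A; y \<in> carrier A\<rbrakk> \<Longrightarrow> x \<preceq> y \<leadsto> (x \<otimes> y)"
  by (simp flip: residuation)

lemma imp_mult_le: "\<lbrakk>y \<in> carrier A; z \<in> carrier A\<rbrakk> \<Longrightarrow> (y \<leadsto> z) \<otimes> y \<preceq> z"
  by (simp add: residuation)

lemma mult_mono:
  assumes "x \<preceq> x'" "y \<preceq> y'"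
    and "x \<in> carrier A" "y \<in> carrier A" "x' \<in> carrier A" "y' \<in> carrier A"
  shows "x \<otimes> y \<preceq> x' \<otimes> y'"
proof -
  have mono: "a \<otimes> c \<preceq> b \<otimes> c"
    if "a \<preceq> b" "a \<in> carrier A" "b \<in> carrier A" "c \<in> carrier A" for a b c
    using le_trans[OF that(1) le_imp_mult[of b c]] that by (simp add: residuation)
  have "x \<otimes> y \<preceq> x' \<otimes> y" "x' \<otimes> y \<preceq> x' \<otimes> y'"
    using mono[of x x' y] mono[of y y' x'] m_comm[of x' y] m_comm[of x' y'] assms by simp_all
  then show ?thesis by (rule le_trans) (simp_all add: assms)
qed

lemma imp_one_left: "x \<in> carrier A \<Longrightarrow> \<one> \<leadsto> x = x"
  by (rule eq_by_lower_bounds) (simp_all flip: residuation)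

lemma one_le_imp_iff: "\<lbrakk>x \<in> carrier A; y \<in> carrier A\<rbrakk> \<Longrightarrow> \<one> \<preceq> x \<leadsto> y \<longleftrightarrow> x \<preceq> y"
  by (simp flip: residuation)

end

lemma gnpcl_Models_basis:
  assumes "gnpcl A"
  shows "A \<in> Models GNPcL_basis"
proof -
  interpret gnpcl A by fact
  have basis: "rl_eval A v (fst e) = rl_eval A v (snd e)"
    if "e \<in> GNPcL_basis" "\<forall>i. v i \<in> carrier A" for e v
  proof -
    note v = that(2)[rule_format]
    have "\<forall>e\<in>GNPcL_basis. rl_eval A v (fst e) = rl_eval A v (snd e)"
      unfolding GNPcL_basis_def Let_def
      unfolding ball_simps(7)
      unfolding fst_conv snd_conv
      unfolding rl_eval.simps
      by (intro conjI ballI)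
        ((rule m_assoc m_comm l_one join_comm meet_comm join_assoc meet_assoc join_absorb meet_absorb
         mult_join imp_meet one_involutive K1 K2[unfolded rl_neg_def] distrib_meet distrib_join
         neg_cone_idem godel le_imp_mult[unfolded rl_le_def] imp_mult_le[unfolded rl_le_def]
         emptyE; (rule v | assumption))+)
    then show ?thesis using that(1) by (rule bspec)
  qed
  show ?thesis unfolding Models_def satisfies_def
    using basis rl_algebra_axioms by simp
qed

lemma GNPcL_eq_Models: "GNPcL = Models GNPcL_basis"
  using gnpcl_Models_basis Models_basis_gnpcl unfolding GNPcL_def by blast

section \<open>The generating algebras\<close>

definition godel_imp :: "nat \<Rightarrow> nat \<Rightarrow> nat \<Rightarrow> nat"
  where "godel_imp n a b = (if a \<le> b then n - 1 else b)"

lemma godel_imp_less: "a < n \<Longrightarrow> b < n \<Longrightarrow> godel_imp n a b < n"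
  by (simp add: godel_imp_def)

lemma K_full_simps:
  "carrier (K_full n) = {..<n} \<times> {..<n}"
  "\<one>\<^bsub>K_full n\<^esub> = (n - 1, n - 1)"
  "(a, b) \<otimes>\<^bsub>K_full n\<^esub> (c, d) = (min a c, min (godel_imp n a d) (godel_imp n c b))"
  "(a, b) \<curlyvee>\<^bsub>K_full n\<^esub> (c, d) = (max a c, min b d)"
  "(a, b) \<curlywedge>\<^bsub>K_full n\<^esub> (c, d) = (min a c, max b d)"
  "(a, b) \<leadsto>\<^bsub>K_full n\<^esub> (c, d) = (min (godel_imp n a c) (godel_imp n d b), min a d)"
  by (simp_all add: K_full_def K_construction_def Godel_chain_def godel_imp_def)

lemma K_full_le_iff: "(a, b) \<preceq>\<^bsub>K_full n\<^esub> (c, d) \<longleftrightarrow> a \<le> c \<and> d \<le> b"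
  by (auto simp: rl_le_def K_full_simps min_def max_def)

lemma le_godel_imp_iff: "a < n \<Longrightarrow> a \<le> godel_imp n b c \<longleftrightarrow> min a b \<le> c"
  by (auto simp: godel_imp_def min_def)

text \<open>Every law reduces coordinatewise to facts about one finite chain: currying, distribution
  of the residual over \<open>min\<close>, the laws of the top, and prelinearity.\<close>

lemma gnpcl_K_full:
  assumes n: "n \<ge> 1"
  shows "gnpcl (K_full n)"
proof -
  have curry: "godel_imp n (min a b) c = godel_imp n a (godel_imp n b c)"
    if "a < n" "b < n" "c < n" for a b c
    using that by (auto simp: godel_imp_def min_def)
  have top: "godel_imp n (n - Suc 0) a = a" "godel_imp n a (n - Suc 0) = n - Suc 0" if "a < n" for a
    using that by (auto simp: godel_imp_def)
  have extremal: "max a (n - Suc 0) = n - Suc 0" "min a (n - Suc 0) = a" "min (n - Suc 0) a = a"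
    if "a < n" for a
    using that by auto
  have distr: "godel_imp n a (min b c) = min (godel_imp n a b) (godel_imp n a c)"
    if "a < n" "b < n" "c < n" for a b c
    using that by (auto simp: godel_imp_def min_def)
  have prelinear: "max (godel_imp n a b) (godel_imp n b a) = n - Suc 0" if "a < n" "b < n" for a b
    using that by (auto simp: godel_imp_def)
  show ?thesis
  proof
    fix x y z assume "x \<in> carrier (K_full n)" "y \<in> carrier (K_full n)" "z \<in> carrier (K_full n)"
    then show "x \<otimes>\<^bsub>K_full n\<^esub> y \<otimes>\<^bsub>K_full n\<^esub> z = x \<otimes>\<^bsub>K_full n\<^esub> (y \<otimes>\<^bsub>K_full n\<^esub> z)"
      by (cases x; cases y; cases z)
        (simp add: K_full_simps distr godel_imp_less min.assoc min.left_commute min.commute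
          flip: curry)
  next
    fix x y z assume "x \<in> carrier (K_full n)" "y \<in> carrier (K_full n)" "z \<in> carrier (K_full n)"
    then show "x \<otimes>\<^bsub>K_full n\<^esub> y \<preceq>\<^bsub>K_full n\<^esub> z \<longleftrightarrow> x \<preceq>\<^bsub>K_full n\<^esub> y \<leadsto>\<^bsub>K_full n\<^esub> z"
      by (cases x; cases y; cases z)
        (auto simp: K_full_simps K_full_le_iff le_godel_imp_iff min.commute)
  next
    fix x y assume "x \<in> carrier (K_full n)" "y \<in> carrier (K_full n)"
    then show "x \<otimes>\<^bsub>K_full n\<^esub> y \<curlywedge>\<^bsub>K_full n\<^esub> \<one>\<^bsub>K_full n\<^esub>
        = (x \<curlywedge>\<^bsub>K_full n\<^esub> \<one>\<^bsub>K_full n\<^esub>) \<otimes>\<^bsub>K_full n\<^esub> (y \<curlywedge>\<^bsub>K_full n\<^esub> \<one>\<^bsub>K_full n\<^esub>)"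
      by (cases x; cases y) (simp add: K_full_simps top extremal godel_imp_less min_less_iff_disj)
  next
    fix x y assume "x \<in> carrier (K_full n)" "y \<in> carrier (K_full n)"
    then show "(x \<curlywedge>\<^bsub>K_full n\<^esub> \<one>\<^bsub>K_full n\<^esub> \<leadsto>\<^bsub>K_full n\<^esub> y) \<curlywedge>\<^bsub>K_full n\<^esub>
        (\<sim>\<^bsub>K_full n\<^esub> y \<curlywedge>\<^bsub>K_full n\<^esub> \<one>\<^bsub>K_full n\<^esub> \<leadsto>\<^bsub>K_full n\<^esub> \<sim>\<^bsub>K_full n\<^esub> x) = x \<leadsto>\<^bsub>K_full n\<^esub> y"
      by (cases x; cases y) (simp add: rl_neg_def K_full_simps top extremal godel_imp_less min.commute)
  next
    fix x y assume "x \<in> carrier (K_full n)" "y \<in> carrier (K_full n)"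
    then show "((x \<curlywedge>\<^bsub>K_full n\<^esub> \<one>\<^bsub>K_full n\<^esub> \<leadsto>\<^bsub>K_full n\<^esub> y) \<curlyvee>\<^bsub>K_full n\<^esub>
        (y \<curlywedge>\<^bsub>K_full n\<^esub> \<one>\<^bsub>K_full n\<^esub> \<leadsto>\<^bsub>K_full n\<^esub> x)) \<curlywedge>\<^bsub>K_full n\<^esub> \<one>\<^bsub>K_full n\<^esub> = \<one>\<^bsub>K_full n\<^esub>"
      by (cases x; cases y) (simp add: K_full_simps top extremal godel_imp_less min_less_iff_disj prelinear)
  qed (use n in \<open>((clarsimp simp: K_full_simps rl_neg_def top extremal godel_imp_less
      min_less_iff_disj; fail) | (clarsimp simp: K_full_simps ac_simps; fail) |
      (clarsimp simp: K_full_simps simp flip: min_max_distrib2 max_min_distrib2; fail))+\<close>)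
qed

lemma K_punctured_simps:
  "carrier (K_punctured n) = {..<n} \<times> {..<n} - {(0, 0)}"
  "\<one>\<^bsub>K_punctured n\<^esub> = \<one>\<^bsub>K_full n\<^esub>"
  "x \<otimes>\<^bsub>K_punctured n\<^esub> y = x \<otimes>\<^bsub>K_full n\<^esub> y"
  "x \<curlyvee>\<^bsub>K_punctured n\<^esub> y = x \<curlyvee>\<^bsub>K_full n\<^esub> y"
  "x \<curlywedge>\<^bsub>K_punctured n\<^esub> y = x \<curlywedge>\<^bsub>K_full n\<^esub> y"
  "x \<leadsto>\<^bsub>K_punctured n\<^esub> y = x \<leadsto>\<^bsub>K_full n\<^esub> y"
  by (simp_all add: K_punctured_def K_full_simps(1))

text \<open>If a product is \<open>(0, 0)\<close>, some factor has first coordinate 0. A residual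
  out of 0 is the top, which differs from 0 as \<open>n \<ge> 2\<close>, so the other residual is 0;
  this forces the second coordinate of the same factor to be 0. The residual is similar.\<close>

lemma rl_algebra_K_punctured:
  assumes "n \<ge> 2"
  shows "rl_algebra (K_punctured n)"
  by unfold_locales
    (use assms in \<open>auto simp: K_punctured_simps K_full_simps godel_imp_def min_def max_def
      split: if_splits\<close>)

lemma theory_K_full_subset_punctured:
  assumes "n \<ge> 2"
  shows "equational_theory (K_full n) \<subseteq> equational_theory (K_punctured n)"
proof (rule equational_theory_embedding[where h = id])
  interpret rl_algebra "K_punctured n" by (rule rl_algebra_K_punctured[OF assms])
  show "hom_on (carrier (K_punctured n)) (K_punctured n) (K_full n) id"
    by (auto simp: hom_on_def K_punctured_simps(2-) simp flip: K_punctured_simps(2-)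
        intro: one_in mult_in join_in meet_in imp_in)
qed (auto simp: K_punctured_simps K_full_simps)

text \<open>Raising both coordinates by one embeds \<open>K_full n\<close> above the new bottom,
  away from \<open>(0, 0)\<close>; \<open>n \<ge> 1\<close> ensures that top goes to top.\<close>

lemma theory_K_punctured_subset_full:
  assumes "n \<ge> 1"
  shows "equational_theory (K_punctured (Suc n)) \<subseteq> equational_theory (K_full n)"
proof (rule equational_theory_embedding[where h = "map_prod Suc Suc"])
  show "hom_on (carrier (K_full n)) (K_full n) (K_punctured (Suc n)) (map_prod Suc Suc)"
    using assms
    by (auto simp: hom_on_def K_punctured_simps K_full_simps godel_imp_def min_def max_def)
  show "inj_on (map_prod Suc Suc) (carrier (K_full n))" by (auto simp: inj_on_def)
qed (auto simp: K_punctured_simps K_full_simps)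

section \<open>Identities that bound the number of elements\<close>

definition eqv_term :: "nat \<Rightarrow> nat \<Rightarrow> rl_term" where
  "eqv_term i j = RMeet (RMeet (RImp (RVar i) (RVar j)) (RImp (RVar j) (RVar i))) ROne"

text \<open>In an algebra whose negative cone is a chain, this identity says that there are at most
  \<open>u\<close> elements.\<close>

definition size_identity :: "nat \<Rightarrow> rl_term \<times> rl_term" where
  "size_identity u = (foldr RJoin (map (\<lambda>(i, j). eqv_term i j)
      (filter (\<lambda>(i, j). i < j) (List.product [0..<Suc u] [0..<Suc u]))) (eqv_term 0 1), ROne)"

lemma rl_eval_punctured: "rl_eval (K_punctured n) v t = rl_eval (K_full n) v t"
  by (induction t) (simp_all add: K_punctured_simps)

lemma rl_eval_eqv_term:
  assumes "v i \<in> carrier (K_full n)" "v j \<in> carrier (K_full n)"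
  obtains c where "rl_eval (K_full n) v (eqv_term i j) = (c, n - 1)" "c < n"
    "c = n - 1 \<longleftrightarrow> v i = v j"
proof -
  obtain a b a' b' where ab: "v i = (a, b)" "v j = (a', b')" by fastforce
  have lt: "a < n" "b < n" "a' < n" "b' < n" using assms ab by (auto simp: K_full_simps)
  let ?c = "min (min (godel_imp n a a') (godel_imp n b' b)) (min (godel_imp n a' a) (godel_imp n b b'))"
  have "godel_imp n x y = n - 1 \<longleftrightarrow> x \<le> y \<or> y = n - 1" for x y by (auto simp: godel_imp_def)
  have c: "?c < n" using lt by (simp add: godel_imp_less min_less_iff_disj)
  have "?c = n - 1 \<longleftrightarrow> a = a' \<and> b = b'"
  proof
    assume "?c = n - 1"
    then have "n - 1 \<le> godel_imp n a a'" "n - 1 \<le> godel_imp n b' b" "n - 1 \<le> godel_imp n a' a"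
      "n - 1 \<le> godel_imp n b b'"
      by linarith+
    then show "a = a' \<and> b = b'" using lt by (auto simp: godel_imp_def split: if_splits)
  next
    assume "a = a' \<and> b = b'"
    then show "?c = n - 1" by (simp add: godel_imp_def)
  qed
  moreover have "rl_eval (K_full n) v (eqv_term i j) = (?c, n - 1)"
    using lt c by (simp add: eqv_term_def ab K_full_simps)
  ultimately show thesis using that[of ?c] c ab by simp
qed

text \<open>All joinands have values in the chain of pairs \<open>(c, n - 1)\<close>, so their join
  is the unit iff one of them is, that is, iff some compared pair of variables has equal
  values.\<close>

lemma rl_eval_join_eqv_terms:
  assumes "\<forall>i. v i \<in> carrier (K_full n)"
  shows "\<exists>c<n. rl_eval (K_full n) v (foldr RJoin (map (\<lambda>(i, j). eqv_term i j) ps) (eqv_term i0 j0))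
      = (c, n - 1) \<and> (c = n - 1 \<longleftrightarrow> (\<exists>(i, j)\<in>set ((i0, j0) # ps). v i = v j))"
proof (induction ps)
  case Nil
  show ?case using assms rl_eval_eqv_term[of v i0 n j0] by auto
next
  case (Cons p ps)
  obtain i j where p: "p = (i, j)" by fastforce
  obtain c where c: "rl_eval (K_full n) v (eqv_term i j) = (c, n - 1)" "c < n"
    "c = n - 1 \<longleftrightarrow> v i = v j"
    using assms rl_eval_eqv_term[of v i n j] by blast
  from Cons.IH obtain d where d: "d < n"
    "rl_eval (K_full n) v (foldr RJoin (map (\<lambda>(i, j). eqv_term i j) ps) (eqv_term i0 j0)) = (d, n - 1)"
    "d = n - 1 \<longleftrightarrow> (\<exists>(i, j)\<in>set ((i0, j0) # ps). v i = v j)"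
    by blast
  have "max c d = n - 1 \<longleftrightarrow> c = n - 1 \<or> d = n - 1" using c(2) d(1) by linarith
  then have "max c d = n - 1 \<longleftrightarrow> (\<exists>(i, j)\<in>set ((i0, j0) # p # ps). v i = v j)"
    unfolding c(3) d(3) p by auto
  moreover have "rl_eval (K_full n) v (foldr RJoin (map (\<lambda>(i, j). eqv_term i j) (p # ps))
      (eqv_term i0 j0)) = (max c d, n - 1)"
    using c(1) d(2) p by (simp add: K_full_simps)
  ultimately show ?case using c(2) d(1) by (intro exI[of _ "max c d"]) simp
qed

text \<open>Pigeonhole: the identity compares the \<open>u + 1\<close> variables 0 to
  \<open>u\<close> and so says that no valuation is injective on them. With \<open>u \<ge> 1\<close>
  the pair \<open>(0, 1)\<close> that starts the fold is one of the compared pairs.\<close>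

lemma size_identity_iff:
  assumes K: "K = K_full n \<or> K = K_punctured n" and u: "u \<ge> 1"
  shows "satisfies K (size_identity u) \<longleftrightarrow> card (carrier K) \<le> u"
proof -
  have sub: "carrier K \<subseteq> carrier (K_full n)" using K by (auto simp: K_punctured_simps K_full_simps)
  have fin: "finite (carrier K)" by (rule finite_subset[OF sub]) (simp add: K_full_simps)
  have eval: "rl_eval K v (fst (size_identity u)) = rl_eval K v (snd (size_identity u))
      \<longleftrightarrow> \<not> inj_on v {..u}" if "\<forall>i. v i \<in> carrier K" for v
  proof -
    have "\<forall>i. v i \<in> carrier (K_full n)" using that sub by blast
    from rl_eval_join_eqv_terms[OF this] obtain c where
      "rl_eval (K_full n) v (fst (size_identity u)) = (c, n - 1)"
      "c = n - 1 \<longleftrightarrow> (\<exists>(i, j)\<in>set ((0, 1) #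
        filter (\<lambda>(i, j). i < j) (List.product [0..<Suc u] [0..<Suc u])). v i = v j)"
      unfolding size_identity_def fst_conv by blast
    moreover have "rl_eval K v t = rl_eval (K_full n) v t" for t
      using K rl_eval_punctured by metis
    moreover have "(\<exists>(i, j)\<in>set ((0, 1) #
        filter (\<lambda>(i, j). i < j) (List.product [0..<Suc u] [0..<Suc u])). v i = v j)
      \<longleftrightarrow> (\<exists>i j. i < j \<and> j \<le> u \<and> v i = v j)"
      using u by (auto simp: less_Suc_eq_le simp del: upt_Suc)
    moreover have "(\<exists>i j. i < j \<and> j \<le> u \<and> v i = v j) \<longleftrightarrow> \<not> inj_on v {..u}"
    proof
      assume "\<exists>i j. i < j \<and> j \<le> u \<and> v i = v j"
      then show "\<not> inj_on v {..u}" by (auto simp: inj_on_def)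
    next
      assume "\<not> inj_on v {..u}"
      then obtain i j where "i \<noteq> j" "i \<le> u" "j \<le> u" "v i = v j" by (auto simp: inj_on_def)
      then show "\<exists>i j. i < j \<and> j \<le> u \<and> v i = v j" by (metis linorder_neqE_nat)
    qed
    moreover have "\<one>\<^bsub>K\<^esub> = (n - 1, n - 1)" using K by (auto simp: K_punctured_simps K_full_simps)
    ultimately show ?thesis by (simp add: size_identity_def)
  qed
  show ?thesis
  proof
    assume sat: "satisfies K (size_identity u)"
    show "card (carrier K) \<le> u"
    proof (rule ccontr)
      assume less: "\<not> card (carrier K) \<le> u"
      obtain f where f: "bij_betw f {0..<card (carrier K)} (carrier K)"
        using ex_bij_betw_nat_finite[OF fin] by blast
      \<comment> \<open>Variables beyond \<open>u\<close> repeat the value at \<open>u\<close>; as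
        \<open>u\<close> is less than the cardinality, all values lie in the carrier.\<close>
      define v where "v i = f (min i u)" for i
      have "v i \<in> carrier K" for i
        using f less by (auto simp: v_def bij_betw_def)
      moreover have "inj_on v {..u}"
        using bij_betw_imp_inj_on[OF f] less by (auto simp: inj_on_def v_def)
      ultimately show False using sat eval by (simp add: satisfies_def)
    qed
  next
    assume le: "card (carrier K) \<le> u"
    have "\<not> inj_on v {..u}" if "\<forall>i. v i \<in> carrier K" for v
      using card_inj_on_le[of v "{..u}" "carrier K"] fin le that by auto
    then show "satisfies K (size_identity u)" using eval by (simp add: satisfies_def)
  qed
qed

text \<open>\<open>1, 3, 4, 8, 9, 15, 16, \<dots>\<close>; the term \<open>1\<close> at index \<open>0\<close> is the trivial algebra \<open>K(G\<^sub>1)\<close>.\<close>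

definition index_seq :: "nat \<Rightarrow> nat" where
  "index_seq m = (if even m then (m div 2 + 1)\<^sup>2 else (m div 2 + 2)\<^sup>2 - 1)"

abbreviation K_seq :: "nat \<Rightarrow> (nat \<times> nat) rl_alg" where "K_seq m \<equiv> K_alg (index_seq m)"

lemma K_seq_even: "K_seq (2 * j) = K_full (Suc j)"
proof (cases "j = 0")
  case True
  \<comment> \<open>The index 1 of the trivial algebra lies outside the range
    \<open>n \<ge> 2\<close> of the lemma on squares.\<close>
  have "floor_sqrt 2 = 1" by (rule floor_sqrt_unique) (simp_all add: power2_eq_square)
  then show ?thesis using True by (simp add: index_seq_def K_alg_def numeral_2_eq_2)
next
  case False
  then show ?thesis using K_alg_square[of "Suc j"] by (simp add: index_seq_def)
qed

lemma K_seq_odd: "K_seq (Suc (2 * j)) = K_punctured (Suc (Suc j))"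
  using K_alg_square_minus_1[of "Suc (Suc j)"] by (simp add: index_seq_def)

lemma K_seq_cases:
  obtains j where "m = 2 * j" "K_seq m = K_full (Suc j)"
  | j where "m = Suc (2 * j)" "K_seq m = K_punctured (Suc (Suc j))"
  using K_seq_even K_seq_odd by (cases "even m") (metis evenE, metis oddE Suc_eq_plus1)

lemma rl_algebra_K_seq: "rl_algebra (K_seq m)"
proof (cases m rule: K_seq_cases)
  case (1 j)
  interpret gnpcl "K_full (Suc j)" by (rule gnpcl_K_full) simp
  show ?thesis unfolding 1(2) by (rule rl_algebra_axioms)
next
  case (2 j)
  then show ?thesis using rl_algebra_K_punctured by simp
qed

lemma finite_K_seq: "finite (carrier (K_seq m))"
  by (cases m rule: K_seq_cases) (auto simp: K_full_simps K_punctured_simps)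

text \<open>The index is the cardinality, so the size identities separate the generators.\<close>

lemma card_K_seq: "card (carrier (K_seq m)) = index_seq m"
proof (cases m rule: K_seq_cases)
  case (1 j)
  show ?thesis unfolding 1(2) unfolding 1(1)
    by (simp add: K_full_simps index_seq_def power2_eq_square)
next
  case (2 j)
  show ?thesis unfolding 2(2) unfolding 2(1)
    by (simp add: K_punctured_simps index_seq_def power2_eq_square card_Diff_subset)
qed

lemma index_seq_strict_mono: "strict_mono index_seq"
unfolding strict_mono_Suc_iff
proof
  fix m
  show "index_seq m < index_seq (Suc m)"
  proof (cases "even m")
    case True
    then obtain j where "m = 2 * j" by blast
    then show ?thesis by (simp add: index_seq_def power2_eq_square)
  next
    case False
    then obtain j where "m = 2 * j + 1" using oddE by blast
    then show ?thesis by (simp add: index_seq_def power2_eq_square)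
  qed
qed

lemma index_seq_pos: "index_seq m \<ge> 1"
  using strict_mono_imp_increasing[OF index_seq_strict_mono, of m]
    strict_mono_less_eq[OF index_seq_strict_mono, of 0 m]
  by (simp add: index_seq_def)

lemma squares_eq_index_seq: "{n\<^sup>2 | n. n \<ge> (2::nat)} = {index_seq m | m. m \<ge> 1 \<and> even m}"
proof (intro equalityI subsetI)
  fix u assume "u \<in> {n\<^sup>2 | n. n \<ge> (2::nat)}"
  then obtain n where "u = n\<^sup>2" "n \<ge> 2" by blast
  then have "u = index_seq (2 * (n - 1))" "2 * (n - 1) \<ge> 1" by (auto simp: index_seq_def)
  then show "u \<in> {index_seq m | m. m \<ge> 1 \<and> even m}" by fastforce
next
  fix u assume "u \<in> {index_seq m | m. m \<ge> 1 \<and> even m}"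
  then obtain m where "u = index_seq m" "m \<ge> 1" "even m" by blast
  then have "u = (m div 2 + 1)\<^sup>2" "m div 2 + 1 \<ge> 2" by (auto simp: index_seq_def)
  then show "u \<in> {n\<^sup>2 | n. n \<ge> (2::nat)}" by blast
qed

lemma squares_minus_1_eq_index_seq: "{n\<^sup>2 - 1 | n. n \<ge> (2::nat)} = {index_seq m | m. odd m}"
proof (intro equalityI subsetI)
  fix u assume "u \<in> {n\<^sup>2 - 1 | n. n \<ge> (2::nat)}"
  then obtain n where "u = n\<^sup>2 - 1" "n \<ge> 2" by blast
  then obtain j where "n = 2 + j" using le_Suc_ex by blast
  then have "u = index_seq (Suc (2 * j))" using \<open>u = n\<^sup>2 - 1\<close> by (simp add: index_seq_def)
  then show "u \<in> {index_seq m | m. odd m}" by fastforce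
next
  fix u assume "u \<in> {index_seq m | m. odd m}"
  then obtain m where "u = index_seq m" "odd m" by blast
  then have "u = (m div 2 + 2)\<^sup>2 - 1" "m div 2 + 2 \<ge> 2" by (auto simp: index_seq_def)
  then show "u \<in> {n\<^sup>2 - 1 | n. n \<ge> (2::nat)}" by blast
qed

lemma K_indices_eq: "K_indices = {index_seq m | m. m \<ge> 1}"
  unfolding K_indices_def squares_eq_index_seq squares_minus_1_eq_index_seq
  by (auto simp: Suc_le_eq odd_pos)

text \<open>Each generator embeds into the next, alternately by the shift of coordinates and by
  inclusion. Conversely, the size identity with bound \<open>index_seq m'\<close> holds in
  \<open>K_seq m'\<close>, and if it also holds in \<open>K_seq m\<close> it bounds that
  cardinality.\<close>

lemma equational_theory_K_seq_iff:
  "equational_theory (K_seq m') \<subseteq> equational_theory (K_seq m) \<longleftrightarrow> m \<le> m'"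
proof
  have "antimono (\<lambda>m. equational_theory (K_seq m))"
  proof (rule antimonoI, erule dec_induct)
    fix k i
    have "equational_theory (K_seq (Suc i)) \<subseteq> equational_theory (K_seq i)"
    proof (cases i rule: K_seq_cases)
      case (1 j)
      then show ?thesis using theory_K_punctured_subset_full[of "Suc j"] K_seq_odd[of j] by simp
    next
      case (2 j)
      then show ?thesis
        using theory_K_full_subset_punctured[of "Suc (Suc j)"] K_seq_even[of "Suc j"] by simp
    qed
    moreover assume "equational_theory (K_seq i) \<subseteq> equational_theory (K_seq k)"
    ultimately show "equational_theory (K_seq (Suc i)) \<subseteq> equational_theory (K_seq k)" by blast
  qed simp
  then show "m \<le> m' \<Longrightarrow> equational_theory (K_seq m') \<subseteq> equational_theory (K_seq m)"
    by (rule antimonoD)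
next
  have size: "size_identity u \<in> equational_theory (K_seq m) \<longleftrightarrow> index_seq m \<le> u" if "u \<ge> 1" for m u
    using size_identity_iff[OF _ that] card_K_seq K_seq_cases[of m]
    unfolding equational_theory_def mem_Collect_eq by metis
  assume "equational_theory (K_seq m') \<subseteq> equational_theory (K_seq m)"
  then have "index_seq m \<le> index_seq m'"
    using size[of "index_seq m'"] index_seq_pos by blast
  then show "m \<le> m'" by (simp add: strict_mono_less_eq[OF index_seq_strict_mono])
qed

text \<open>The axioms are verified for the full algebras; \<open>K_seq (2 * m)\<close> is full and
  \<open>K_seq m\<close> comes no later in the chain, so it inherits them.\<close>

lemma GNPcL_basis_K_seq: "GNPcL_basis \<subseteq> equational_theory (K_seq m)"
proof -
  have "GNPcL_basis \<subseteq> equational_theory (K_seq (2 * m))"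
    using gnpcl_Models_basis[OF gnpcl_K_full, of "Suc m"] by (simp add: K_seq_even Models_iff)
  then show ?thesis using equational_theory_K_seq_iff[of "2 * m" m] by fastforce
qed

section \<open>Coordinates in the negative cone\<close>

context crl
begin

lemma neg_in [simp, intro]: "x \<in> carrier A \<Longrightarrow> \<sim> x \<in> carrier A"
  by (simp add: rl_neg_def)

lemma le_neg_iff: "\<lbrakk>x \<in> carrier A; y \<in> carrier A\<rbrakk> \<Longrightarrow> x \<preceq> \<sim> y \<longleftrightarrow> y \<preceq> \<sim> x"
  unfolding rl_neg_def using residuation[of x y \<one>] residuation'[of y x \<one>] by simp

lemma neg_join:
  assumes "x \<in> carrier A" "y \<in> carrier A"
  shows "\<sim> (x \<curlyvee> y) = \<sim> x \<curlywedge> \<sim> y"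
proof (rule eq_by_lower_bounds)
  fix w assume w: "w \<in> carrier A"
  then show "w \<preceq> \<sim> (x \<curlyvee> y) \<longleftrightarrow> w \<preceq> \<sim> x \<curlywedge> \<sim> y"
    using assms by (simp add: le_neg_iff[of w] le_meet_iff join_le_iff)
qed (use assms in simp_all)

lemma neg_mult: "\<lbrakk>x \<in> carrier A; y \<in> carrier A\<rbrakk> \<Longrightarrow> \<sim> (x \<otimes> y) = x \<leadsto> \<sim> y"
  by (simp add: rl_neg_def imp_curry)

lemma neg_one: "\<sim> \<one> = \<one>"
  by (simp add: rl_neg_def imp_one_left)

lemma meet_le_left: "\<lbrakk>x \<preceq> z; x \<in> carrier A; y \<in> carrier A; z \<in> carrier A\<rbrakk> \<Longrightarrow> x \<curlywedge> y \<preceq> z"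
  using le_trans[OF meet_le1] by blast

lemma meet_le_right: "\<lbrakk>y \<preceq> z; x \<in> carrier A; y \<in> carrier A; z \<in> carrier A\<rbrakk> \<Longrightarrow> x \<curlywedge> y \<preceq> z"
  using le_trans[OF meet_le2] by blast

end

lemma (in K_lattice) neg_neg: "x \<in> carrier A \<Longrightarrow> \<sim> (\<sim> x) = x"
  by (simp add: rl_neg_def one_involutive)

lemma (in K_lattice) neg_meet:
  assumes "x \<in> carrier A" "y \<in> carrier A"
  shows "\<sim> (x \<curlywedge> y) = \<sim> x \<curlyvee> \<sim> y"
proof -
  have "\<sim> (\<sim> x \<curlyvee> \<sim> y) = x \<curlywedge> y" using assms by (simp add: neg_join neg_neg)
  then show ?thesis using neg_neg[of "\<sim> x \<curlyvee> \<sim> y"] assms by simp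
qed

lemma (in K_lattice) neg_imp:
  assumes "x \<in> carrier A" "y \<in> carrier A"
  shows "\<sim> (x \<leadsto> y) = x \<otimes> \<sim> y"
  using neg_mult[of x "\<sim> y"] neg_neg[of "x \<otimes> \<sim> y"] assms by (simp add: neg_neg)

text \<open>\<open>coord1\<close> and \<open>coord2\<close> are the components of the embedding of \<open>A\<close> into \<open>K(A\<^sup>-)\<close>.\<close>

definition coord1 :: "'a rl_alg \<Rightarrow> 'a \<Rightarrow> 'a" where
  "coord1 A x = x \<curlywedge>\<^bsub>A\<^esub> \<one>\<^bsub>A\<^esub>"

definition coord2 :: "'a rl_alg \<Rightarrow> 'a \<Rightarrow> 'a" where
  "coord2 A x = \<sim>\<^bsub>A\<^esub> x \<curlywedge>\<^bsub>A\<^esub> \<one>\<^bsub>A\<^esub>"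

text \<open>The residual of the negative cone: the ambient residual can leave the cone, so it is cut
  off at the unit.\<close>

definition cone_imp :: "'a rl_alg \<Rightarrow> 'a \<Rightarrow> 'a \<Rightarrow> 'a" where
  "cone_imp A x y = (x \<leadsto>\<^bsub>A\<^esub> y) \<curlywedge>\<^bsub>A\<^esub> \<one>\<^bsub>A\<^esub>"

definition cone :: "'a rl_alg \<Rightarrow> 'a set" where
  "cone A = {x \<in> carrier A. x \<preceq>\<^bsub>A\<^esub> \<one>\<^bsub>A\<^esub>}"

context npcl
begin

lemma cone_carrier [simp]: "x \<in> cone A \<Longrightarrow> x \<in> carrier A"
  by (simp add: cone_def)

lemma cone_le_one [simp]: "x \<in> cone A \<Longrightarrow> x \<preceq> \<one>"
  unfolding cone_def by blast

lemma cone_closed [simp]: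
  "\<one> \<in> cone A"
  "x \<in> carrier A \<Longrightarrow> coord1 A x \<in> cone A"
  "x \<in> carrier A \<Longrightarrow> coord2 A x \<in> cone A"
  "\<lbrakk>x \<in> carrier A; y \<in> carrier A\<rbrakk> \<Longrightarrow> cone_imp A x y \<in> cone A"
  "\<lbrakk>x \<in> cone A; y \<in> carrier A\<rbrakk> \<Longrightarrow> x \<curlywedge> y \<in> cone A"
  "\<lbrakk>x \<in> cone A; y \<in> cone A\<rbrakk> \<Longrightarrow> x \<curlyvee> y \<in> cone A"
  by (simp_all add: cone_def coord1_def coord2_def cone_imp_def join_le_iff meet_le_left
      del: cone_le_one cone_carrier)

lemma cone_meet_one: "x \<in> cone A \<Longrightarrow> x \<curlywedge> \<one> = x"
  using cone_le_one[of x] by (simp add: rl_le_def)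

text \<open>Below the unit a product lies under both factors, and idempotency of
  \<open>x \<curlywedge> y\<close> gives the converse inequality. The cone is therefore
  Brouwerian.\<close>

lemma cone_mult:
  assumes "x \<in> cone A" "y \<in> cone A"
  shows "x \<otimes> y = x \<curlywedge> y"
proof (rule le_antisym)
  have "x \<otimes> y \<preceq> x \<otimes> \<one>" "x \<otimes> y \<preceq> \<one> \<otimes> y" using assms by (intro mult_mono; simp)+
  then show "x \<otimes> y \<preceq> x \<curlywedge> y" using assms by (simp add: le_meet_iff)
  have "(x \<curlywedge> y) \<otimes> (x \<curlywedge> y) = x \<curlywedge> y"
    using neg_cone_idem[of "x \<curlywedge> y"] cone_meet_one[of "x \<curlywedge> y"] assms by simp
  moreover have "(x \<curlywedge> y) \<otimes> (x \<curlywedge> y) \<preceq> x \<otimes> y" using assms by (intro mult_mono) simp_all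
  ultimately show "x \<curlywedge> y \<preceq> x \<otimes> y" by simp
qed (use assms in simp_all)

lemma le_cone_imp_iff:
  assumes "x \<in> cone A" "y \<in> cone A" "z \<in> carrier A"
  shows "x \<preceq> cone_imp A y z \<longleftrightarrow> x \<curlywedge> y \<preceq> z"
  using assms by (simp add: cone_imp_def le_meet_iff flip: residuation cone_mult)

text \<open>Since \<open>x\<close> is below the unit, \<open>x \<leadsto> \<one>\<close> is above
  it, so truncating \<open>y\<close> has no effect once the residual is truncated.\<close>

lemma cone_imp_coord1:
  assumes "x \<in> cone A" "y \<in> carrier A"
  shows "(x \<leadsto> y) \<curlywedge> \<one> = cone_imp A x (y \<curlywedge> \<one>)"
proof -
  have "x \<otimes> \<one> \<preceq> \<one>" using assms by simp
  then have "\<one> \<preceq> x \<leadsto> \<one>" using assms by (simp add: one_le_imp_iff)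
  then have "(x \<leadsto> \<one>) \<curlywedge> \<one> = \<one>" using assms meet_comm[of "x \<leadsto> \<one>" \<one>] by (simp add: rl_le_def)
  then show ?thesis using assms by (simp add: cone_imp_def imp_meet meet_assoc)
qed

lemma coord1_one: "coord1 A \<one> = \<one>" and coord2_one: "coord2 A \<one> = \<one>"
  by (simp_all add: coord1_def coord2_def neg_one meet_idem)

lemma coord_cone: "x \<in> cone A \<Longrightarrow> coord1 A x = x" "x \<in> cone A \<Longrightarrow> coord2 A x = \<one>"
proof -
  assume x: "x \<in> cone A"
  then show "coord1 A x = x" by (simp add: coord1_def cone_meet_one)
  have "\<one> \<preceq> \<sim> x" using x le_neg_iff[of \<one> x] by (simp add: neg_one)
  then show "coord2 A x = \<one>" using meet_comm[of "\<sim> x" \<one>] x by (simp add: coord2_def rl_le_def)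
qed

lemma join_meet_distrib:
  assumes "x \<in> carrier A" "y \<in> carrier A" "z \<in> carrier A"
  shows "(x \<curlyvee> y) \<curlywedge> z = (x \<curlywedge> z) \<curlyvee> (y \<curlywedge> z)"
  using distrib_meet[of z x y] assms meet_comm[of z x] meet_comm[of z y] meet_comm[of z "x \<curlyvee> y"]
  by simp

lemma meet_meet_distrib:
  assumes "x \<in> carrier A" "y \<in> carrier A" "z \<in> carrier A"
  shows "(x \<curlywedge> y) \<curlywedge> z = (x \<curlywedge> z) \<curlywedge> (y \<curlywedge> z)"
  by (rule eq_by_lower_bounds) (use assms in \<open>auto simp: le_meet_iff\<close>)

lemma coord1_join: "\<lbrakk>x \<in> carrier A; y \<in> carrier A\<rbrakk> \<Longrightarrow> coord1 A (x \<curlyvee> y) = coord1 A x \<curlyvee> coord1 A y"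
  by (simp add: coord1_def join_meet_distrib)

lemma coord1_meet: "\<lbrakk>x \<in> carrier A; y \<in> carrier A\<rbrakk> \<Longrightarrow> coord1 A (x \<curlywedge> y) = coord1 A x \<curlywedge> coord1 A y"
  unfolding coord1_def by (rule meet_meet_distrib) simp_all

lemma coord1_mult: "\<lbrakk>x \<in> carrier A; y \<in> carrier A\<rbrakk> \<Longrightarrow> coord1 A (x \<otimes> y) = coord1 A x \<curlywedge> coord1 A y"
  using cone_mult[of "coord1 A x" "coord1 A y"] by (simp add: coord1_def K1 cone_closed(2)[unfolded coord1_def])

text \<open>Through negation, the laws of the second coordinate follow from those of the
  first.\<close>

lemma coord2_eq: "coord2 A x = coord1 A (\<sim> x)"
  by (simp add: coord1_def coord2_def)

text \<open>This is (K2) met with the unit; the right side is the first component of the residual in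
  \<open>K_construction\<close>.\<close>

lemma coord1_imp:
  assumes "x \<in> carrier A" "y \<in> carrier A"
  shows "coord1 A (x \<leadsto> y)
       = cone_imp A (coord1 A x) (coord1 A y) \<curlywedge> cone_imp A (coord2 A y) (coord2 A x)"
proof -
  have "coord1 A (x \<leadsto> y) = ((coord1 A x \<leadsto> y) \<curlywedge> \<one>) \<curlywedge> ((coord2 A y \<leadsto> \<sim> x) \<curlywedge> \<one>)"
    using K2[of x y] assms meet_meet_distrib[of "coord1 A x \<leadsto> y" "coord2 A y \<leadsto> \<sim> x" \<one>]
    by (simp add: coord1_def coord2_def)
  then show ?thesis
    using cone_imp_coord1[of "coord1 A x" y] cone_imp_coord1[of "coord2 A y" "\<sim> x"] assms
    by (simp add: coord1_def[of A y] coord2_def[of A x])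
qed

lemma coord2_join: "\<lbrakk>x \<in> carrier A; y \<in> carrier A\<rbrakk> \<Longrightarrow> coord2 A (x \<curlyvee> y) = coord2 A x \<curlywedge> coord2 A y"
  by (simp add: coord2_eq neg_join coord1_meet)

lemma coord2_meet: "\<lbrakk>x \<in> carrier A; y \<in> carrier A\<rbrakk> \<Longrightarrow> coord2 A (x \<curlywedge> y) = coord2 A x \<curlyvee> coord2 A y"
  by (simp add: coord2_eq neg_meet coord1_join)

lemma coord2_mult:
  "\<lbrakk>x \<in> carrier A; y \<in> carrier A\<rbrakk> \<Longrightarrow> coord2 A (x \<otimes> y)
    = cone_imp A (coord1 A x) (coord2 A y) \<curlywedge> cone_imp A (coord1 A y) (coord2 A x)"
  by (simp add: coord2_eq neg_mult coord1_imp neg_neg)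

lemma coord2_imp: "\<lbrakk>x \<in> carrier A; y \<in> carrier A\<rbrakk> \<Longrightarrow> coord2 A (x \<leadsto> y) = coord1 A x \<curlywedge> coord2 A y"
  by (simp add: coord2_eq neg_imp coord1_mult)

text \<open>The coordinates determine \<open>x \<curlywedge> \<one>\<close> and \<open>x \<curlyvee> \<one>\<close>, hence \<open>x\<close> by distributivity.\<close>

lemma coord_inject:
  assumes x: "x \<in> carrier A" and y: "y \<in> carrier A"
    and eq: "coord1 A x = coord1 A y" "coord2 A x = coord2 A y"
  shows "x = y"
proof -
  have meet: "x \<curlywedge> \<one> = y \<curlywedge> \<one>" using eq by (simp add: coord1_def)
  have join_one: "\<sim> (coord2 A z) = z \<curlyvee> \<one>" if "z \<in> carrier A" for z
    using that by (simp add: coord2_def neg_meet neg_neg neg_one)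
  have join: "x \<curlyvee> \<one> = y \<curlyvee> \<one>" using join_one[OF x] join_one[OF y] eq by simp
  have "x = x \<curlywedge> (y \<curlyvee> \<one>)" using meet_absorb[of x \<one>] x join by simp
  also have "\<dots> = (x \<curlywedge> y) \<curlyvee> (y \<curlywedge> \<one>)" using x y meet by (simp add: distrib_meet)
  also have "\<dots> = y \<curlywedge> (x \<curlyvee> \<one>)" using x y meet_comm[of x y] by (simp add: distrib_meet)
  also have "\<dots> = y" using meet_absorb[of y \<one>] y join by simp
  finally show ?thesis .
qed

end

section \<open>Finite quotient chains\<close>

text \<open>The rank of an element is the number of elements strictly below it; it is injective with
  values below \<open>card C\<close>, hence onto by counting.\<close>

lemma finite_chain_rank:
  fixes le :: "'a \<Rightarrow> 'a \<Rightarrow> bool"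
  assumes fin: "finite C"
    and antisym: "\<And>x y. \<lbrakk>x \<in> C; y \<in> C; le x y; le y x\<rbrakk> \<Longrightarrow> x = y"
    and trans: "\<And>x y z. \<lbrakk>x \<in> C; y \<in> C; z \<in> C; le x y; le y z\<rbrakk> \<Longrightarrow> le x z"
    and total: "\<And>x y. \<lbrakk>x \<in> C; y \<in> C\<rbrakk> \<Longrightarrow> le x y \<or> le y x"
  shows "\<exists>r. bij_betw r C {..<card C} \<and> (\<forall>x\<in>C. \<forall>y\<in>C. r x \<le> r y \<longleftrightarrow> le x y)"
proof -
  define below where "below x = {y \<in> C. \<not> le x y}" for x
  define r where "r x = card (below x)" for x
  have fin_below: "finite (below x)" for x using fin by (simp add: below_def)
  have mono: "r x \<le> r y" if "x \<in> C" "y \<in> C" "le x y" for x y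
  proof -
    have "below x \<subseteq> below y" using that trans unfolding below_def by blast
    then show ?thesis unfolding r_def by (rule card_mono[OF fin_below])
  qed
  have strict: "r x < r y" if xy: "x \<in> C" "y \<in> C" "\<not> le y x" for x y
  proof -
    have "le x y" using total xy by blast
    then have "below x \<subseteq> below y" using xy trans unfolding below_def by blast
    moreover have "x \<in> below y" "x \<notin> below x" using xy total[of x x] by (auto simp: below_def)
    ultimately show ?thesis unfolding r_def by (intro psubset_card_mono[OF fin_below]) blast
  qed
  have iff: "r x \<le> r y \<longleftrightarrow> le x y" if "x \<in> C" "y \<in> C" for x y
    using mono strict that by (meson linorder_not_le)
  have inj: "inj_on r C"
    using iff antisym by (intro inj_onI) (metis order_refl)
  have "r ` C \<subseteq> {..<card C}"
  proof
    fix k assume "k \<in> r ` C"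
    then obtain x where x: "x \<in> C" "k = r x" by blast
    have "below x \<subset> C" using x total[of x x] by (auto simp: below_def)
    then show "k \<in> {..<card C}" using x psubset_card_mono[OF fin] by (simp add: r_def)
  qed
  then have "r ` C = {..<card C}"
    using card_image[OF inj] by (intro card_subset_eq) simp_all
  then show ?thesis using inj iff by (intro exI[of _ r]) (simp add: bij_betw_def)
qed

text \<open>Residuation into the unit swaps coordinates. For \<open>b < a\<close>, the product of
  \<open>(a, n - 1)\<close> and \<open>(n - 1, b)\<close> is \<open>(a, b)\<close>, because the
  chain residual of \<open>a\<close> and \<open>b\<close> is then \<open>b\<close>; swapping yields
  the pairs with \<open>a < b\<close>.\<close>

lemma closed_subset_K_full:
  assumes closed: "\<And>x y. \<lbrakk>x \<in> T; y \<in> T\<rbrakk> \<Longrightarrow>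
      x \<otimes>\<^bsub>K_full n\<^esub> y \<in> T \<and> x \<curlywedge>\<^bsub>K_full n\<^esub> y \<in> T \<and> x \<leadsto>\<^bsub>K_full n\<^esub> y \<in> T"
    and cone: "\<And>a. a < n \<Longrightarrow> (a, n - 1) \<in> T"
  shows "carrier (K_full n) - {(0, 0)} \<subseteq> T"
proof -
  have top: "godel_imp n (n - Suc 0) b = b" "godel_imp n b (n - Suc 0) = n - Suc 0"
    "min b (n - Suc 0) = b" "min (n - Suc 0) b = b" if "b < n" for b
    using that by (auto simp: godel_imp_def)
  have flip: "(b, a) \<in> T" if "(a, b) \<in> T" "a < n" "b < n" for a b
    using closed[OF that(1) cone[of "n - 1"]] that by (simp add: K_full_simps top)
  have greater: "(a, b) \<in> T" if "b < a" "a < n" for a b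
    using closed[OF cone[of a] flip[OF cone[of b]]] that
    by (simp add: K_full_simps top godel_imp_def[of n a b])
  have less: "(a, b) \<in> T" if "a < b" "b < n" for a b
    using flip[OF greater[of a b]] that by simp
  \<comment> \<open>\<open>(a, a)\<close> is the meet of \<open>(a, 0)\<close> and
    \<open>(n - 1, a)\<close>. The former is available only for \<open>0 < a\<close>, which is why
    \<open>(0, 0)\<close> escapes.\<close>
  have diag: "(a, a) \<in> T" if "0 < a" "a < n" for a
    using closed[OF greater[of 0 a] flip[OF cone[of a]]] that by (simp add: K_full_simps top)
  show ?thesis
    using greater less diag by (auto simp: K_full_simps) (metis linorder_neqE_nat neq0_conv)+
qed

context npcl
begin

lemma meet_mono:
  assumes "x \<preceq> x'" "y \<preceq> y'"
    and "x \<in> carrier A" "y \<in> carrier A" "x' \<in> carrier A" "y' \<in> carrier A"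
  shows "x \<curlywedge> y \<preceq> x' \<curlywedge> y'"
  using assms by (simp add: le_meet_iff meet_le_left meet_le_right)

lemma le_meet_both:
  assumes "w \<preceq> f" "w \<in> carrier A" "f \<in> carrier A" "x \<in> carrier A" "y \<in> carrier A"
  shows "w \<curlywedge> x \<preceq> y \<longleftrightarrow> w \<curlywedge> (f \<curlywedge> x) \<preceq> f \<curlywedge> y"
proof -
  have "w \<curlywedge> (f \<curlywedge> x) = w \<curlywedge> x"
    using assms meet_assoc[of w f x] by (simp add: rl_le_def)
  moreover have "w \<curlywedge> x \<preceq> f" using assms by (simp add: meet_le_left)
  ultimately show ?thesis using assms by (simp add: le_meet_iff)
qed

text \<open>Only elements \<open>w\<close> below \<open>f\<close> matter, and for these the
  condition \<open>w \<curlywedge> x \<preceq> y\<close> depends on \<open>x\<close> and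
  \<open>y\<close> only through their meets with \<open>f\<close>. Agreement below \<open>f\<close>
  is the congruence of the filter above \<open>f\<close>.\<close>

lemma cone_imp_cong_below:
  assumes f: "f \<in> cone A" and "x \<in> cone A" "x' \<in> cone A" "y \<in> cone A" "y' \<in> cone A"
    and eq: "f \<curlywedge> x = f \<curlywedge> x'" "f \<curlywedge> y = f \<curlywedge> y'"
  shows "f \<curlywedge> cone_imp A x y = f \<curlywedge> cone_imp A x' y'"
proof (rule eq_by_lower_bounds)
  fix w assume w: "w \<in> carrier A"
  show "w \<preceq> f \<curlywedge> cone_imp A x y \<longleftrightarrow> w \<preceq> f \<curlywedge> cone_imp A x' y'"
  proof (cases "w \<preceq> f")
    case True
    then have "w \<preceq> \<one>" using le_trans[OF True, of \<one>] f w by simp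
    then have "w \<in> cone A" using w by (simp add: cone_def del: cone_carrier cone_le_one)
    then show ?thesis
      using assms True le_meet_both[of w f x y] le_meet_both[of w f x' y']
      by (simp add: le_meet_iff le_cone_imp_iff)
  qed (use assms w in \<open>simp add: le_meet_iff\<close>)
qed (use assms in simp_all)

end

context gnpcl
begin

lemma prelinear:
  assumes "x \<in> cone A" "y \<in> cone A"
  shows "cone_imp A x y \<curlyvee> cone_imp A y x = \<one>"
  using godel[of x y] assms join_meet_distrib[of "x \<leadsto> y" "y \<leadsto> x" \<one>]
  by (simp add: cone_meet_one cone_imp_def)

text \<open>By prelinearity, \<open>f = (f \<curlywedge> (x \<rightarrow> y)) \<curlyvee> (f \<curlywedge> (y \<rightarrow> x))\<close>; if \<open>f\<close> is not below \<open>w\<close>, then one of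
  the two joinands is not below \<open>w\<close>. This replaces the choice of a prime filter.\<close>

lemma decisive_element:
  assumes "finite P" "P \<subseteq> cone A \<times> cone A" and w: "w \<in> cone A" "w \<noteq> \<one>"
  shows "\<exists>f\<in>cone A. \<not> f \<preceq> w \<and> (\<forall>(x, y)\<in>P. f \<curlywedge> x \<preceq> y \<or> f \<curlywedge> y \<preceq> x)"
  using assms(1,2)
proof (induction P rule: finite_induct)
  case empty
  have "\<not> \<one> \<preceq> w" using le_antisym[of w \<one>] w by auto
  then show ?case using cone_closed(1) by auto
next
  case (insert p P)
  obtain x y where p: "p = (x, y)" by fastforce
  have xy: "x \<in> cone A" "y \<in> cone A" using insert.prems p by auto
  from insert obtain f where f: "f \<in> cone A" "\<not> f \<preceq> w"
    and P: "\<forall>(x, y)\<in>P. f \<curlywedge> x \<preceq> y \<or> f \<curlywedge> y \<preceq> x" by blast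
  have "f = (f \<curlywedge> cone_imp A x y) \<curlyvee> (f \<curlywedge> cone_imp A y x)"
    using xy f prelinear distrib_meet[of f "cone_imp A x y" "cone_imp A y x"]
    by (simp add: cone_meet_one)
  then have "\<not> f \<curlywedge> cone_imp A x y \<preceq> w \<or> \<not> f \<curlywedge> cone_imp A y x \<preceq> w"
    using f xy w join_le_iff[of "f \<curlywedge> cone_imp A x y" "f \<curlywedge> cone_imp A y x" w] by auto
  then obtain a b where ab: "(a, b) = (x, y) \<or> (a, b) = (y, x)"
    and not_le: "\<not> f \<curlywedge> cone_imp A a b \<preceq> w" by blast
  let ?f = "f \<curlywedge> cone_imp A a b"
  have a: "a \<in> cone A" "b \<in> cone A" using ab xy by auto
  have f': "?f \<in> cone A" using f a by simp
  have "?f \<curlywedge> a \<preceq> b" using le_cone_imp_iff[OF f', of a b] a f by simp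
  then have "?f \<curlywedge> x \<preceq> y \<or> ?f \<curlywedge> y \<preceq> x" using ab by auto
  \<comment> \<open>Shrinking \<open>f\<close> preserves the comparisons that are already
    decided.\<close>
  moreover have "?f \<curlywedge> c \<preceq> d" if "f \<curlywedge> c \<preceq> d" "c \<in> cone A" "d \<in> cone A" for c d
    by (rule le_trans[OF meet_mono[of ?f f c c] that(1)]) (use that f a in simp_all)
  then have "\<forall>(x, y)\<in>P. ?f \<curlywedge> x \<preceq> y \<or> ?f \<curlywedge> y \<preceq> x"
    using P insert.prems by fastforce
  ultimately show ?case using f' not_le p by blast
qed

end

context gnpcl
begin

text \<open>The meets of \<open>f\<close> with the elements of \<open>D\<close> form a chain that is
  closed, modulo \<open>f\<close>, under all operations of the cone; its ranks serve as coordinates.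
  The last clause records that \<open>h\<close> identifies only elements whose coordinates agree
  below \<open>f\<close>.\<close>

lemma hom_to_K_full:
  assumes D: "finite D" "D \<subseteq> cone A" "\<one> \<in> D" and f: "f \<in> cone A"
    and decisive: "\<forall>x\<in>D \<union> case_prod (cone_imp A) ` (D \<times> D).
        \<forall>y\<in>D \<union> case_prod (cone_imp A) ` (D \<times> D). f \<curlywedge> x \<preceq> y \<or> f \<curlywedge> y \<preceq> x"
  shows "\<exists>S n h. hom_on S A (K_full n) h \<and> n \<ge> 1 \<and> h ` S \<subseteq> carrier (K_full n) \<and>
    (\<forall>a<n. (a, n - 1) \<in> h ` S) \<and>
    (\<forall>x\<in>carrier A. coord1 A x \<in> D \<longrightarrow> coord2 A x \<in> D \<longrightarrow> x \<in> S) \<and>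
    (\<forall>x\<in>S. \<forall>y\<in>S. h x = h y \<longrightarrow>
      f \<curlywedge> coord1 A x = f \<curlywedge> coord1 A y \<and> f \<curlywedge> coord2 A x = f \<curlywedge> coord2 A y)"
proof -
  note decisive = decisive[rule_format]
  define C where "C = (\<lambda>d. f \<curlywedge> d) ` D"
  define n where "n = card C"
  have D_cone: "d \<in> cone A" if "d \<in> D" for d using that D by blast
  have C_cone: "c \<in> cone A" if "c \<in> C" for c using that f D_cone by (auto simp: C_def)
  have C_le: "c \<preceq> f" if "c \<in> C" for c using that f D_cone by (auto simp: C_def)
  \<comment> \<open>With the unit in \<open>D\<close>, the element \<open>f\<close> is the top of
    the chain \<open>C\<close> and will get rank \<open>n - 1\<close>.\<close>
  have "f \<curlywedge> \<one> = f" using f by (rule cone_meet_one)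
  then have f_C: "f \<in> C" using D(3) unfolding C_def by force
  have fin: "finite C" using D by (simp add: C_def)
  have total: "c \<preceq> c' \<or> c' \<preceq> c" if c: "c \<in> C" "c' \<in> C" for c c'
  proof -
    obtain d d' where d: "d \<in> D" "c = f \<curlywedge> d" "d' \<in> D" "c' = f \<curlywedge> d'"
      using c by (auto simp: C_def)
    then show ?thesis using decisive[of d d'] f D_cone by (auto simp: le_meet_iff)
  qed
  have carr: "c \<in> carrier A" if "c \<in> C" for c using C_cone[OF that] by simp
  have antisym: "c = c'" if "c \<in> C" "c' \<in> C" "c \<preceq> c'" "c' \<preceq> c" for c c'
    using le_antisym[OF that(3,4)] that(1,2) carr by blast
  have trans: "c \<preceq> c''" if "c \<in> C" "c' \<in> C" "c'' \<in> C" "c \<preceq> c'" "c' \<preceq> c''" for c c' c''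
    using le_trans[OF that(4,5)] that(1-3) carr by blast
  have "\<exists>r. bij_betw r C {..<card C} \<and> (\<forall>c\<in>C. \<forall>c'\<in>C. r c \<le> r c' \<longleftrightarrow> c \<preceq> c')"
    by (rule finite_chain_rank[OF fin]; (rule antisym | rule trans | rule total); assumption)
  then obtain r where r: "bij_betw r C {..<n}"
    and r_le: "\<And>c c'. \<lbrakk>c \<in> C; c' \<in> C\<rbrakk> \<Longrightarrow> r c \<le> r c' \<longleftrightarrow> c \<preceq> c'"
    unfolding n_def by blast
  have r_less: "r c < n" if "c \<in> C" for c using bij_betwE[OF r] that by blast
  have n: "n \<ge> 1" using r_less[OF f_C] by simp
  have r_f: "r f = n - 1"
  proof -
    obtain c where c: "c \<in> C" "r c = n - 1"
      using bij_betw_imp_surj_on[OF r] n by (metis diff_less imageE lessThan_iff less_le_trans zero_less_one)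
    then have "r c \<le> r f" using r_le f_C C_le by blast
    then show ?thesis using c r_less[OF f_C] by simp
  qed
  \<comment> \<open>\<open>B\<close> consists of the cone elements that agree below \<open>f\<close>
    with some element of \<open>D\<close>. Unlike \<open>D\<close>, it is always closed under the
    operations.\<close>
  define B where "B = {x \<in> cone A. f \<curlywedge> x \<in> C}"
  define g where "g x = r (f \<curlywedge> x)" for x
  have B_cone: "x \<in> cone A" "f \<curlywedge> x \<in> C" if "x \<in> B" for x using that by (simp_all add: B_def)
  have D_B: "d \<in> B" if "d \<in> D" for d using that D_cone by (auto simp: B_def C_def)
  have g_less: "g x < n" if "x \<in> B" for x using r_less B_cone that by (simp add: g_def)
  have g_le: "g x \<le> g y \<longleftrightarrow> f \<curlywedge> x \<preceq> y" if "x \<in> B" "y \<in> B" for x y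
    using r_le B_cone that f by (simp add: g_def le_meet_iff)
  have one: "\<one> \<in> B" "g \<one> = n - 1"
    using D_B[OF D(3)] r_f f by (simp_all add: g_def cone_meet_one)
  have eqI: "z \<in> B \<and> g z = g w" if "z \<in> cone A" "w \<in> B" "f \<curlywedge> z = f \<curlywedge> w" for z w
    using that by (simp add: B_def g_def)
  have meet: "x \<curlywedge> y \<in> B \<and> g (x \<curlywedge> y) = min (g x) (g y)" if xy: "x \<in> B" "y \<in> B" for x y
  proof -
    have "f \<curlywedge> (x \<curlywedge> y) = (f \<curlywedge> x) \<curlywedge> (f \<curlywedge> y)"
      by (rule eq_by_lower_bounds) (use xy B_cone f in \<open>auto simp: le_meet_iff\<close>)
    moreover have "f \<curlywedge> x \<preceq> f \<curlywedge> y \<or> f \<curlywedge> y \<preceq> f \<curlywedge> x" using total B_cone xy by blast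
    ultimately have "f \<curlywedge> (x \<curlywedge> y) = f \<curlywedge> x \<and> g x \<le> g y \<or> f \<curlywedge> (x \<curlywedge> y) = f \<curlywedge> y \<and> g y \<le> g x"
      using r_le B_cone xy meet_comm[of "f \<curlywedge> x" "f \<curlywedge> y"] f by (auto simp: rl_le_def g_def)
    then show ?thesis
      using eqI[of "x \<curlywedge> y" x] eqI[of "x \<curlywedge> y" y] xy B_cone by (auto simp: min_def)
  qed
  have join: "x \<curlyvee> y \<in> B \<and> g (x \<curlyvee> y) = max (g x) (g y)" if xy: "x \<in> B" "y \<in> B" for x y
  proof -
    have "f \<curlywedge> (x \<curlyvee> y) = (f \<curlywedge> x) \<curlyvee> (f \<curlywedge> y)" using xy B_cone f by (simp add: distrib_meet)
    moreover have "f \<curlywedge> x \<preceq> f \<curlywedge> y \<or> f \<curlywedge> y \<preceq> f \<curlywedge> x" using total B_cone xy by blast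
    ultimately have "f \<curlywedge> (x \<curlyvee> y) = f \<curlywedge> y \<and> g x \<le> g y \<or> f \<curlywedge> (x \<curlyvee> y) = f \<curlywedge> x \<and> g y \<le> g x"
      using r_le B_cone xy join_comm[of "f \<curlywedge> x" "f \<curlywedge> y"] f by (auto simp: le_iff_join g_def)
    then show ?thesis
      using eqI[of "x \<curlyvee> y" x] eqI[of "x \<curlyvee> y" y] xy B_cone by (auto simp: max_def)
  qed
  have imp: "cone_imp A x y \<in> B \<and> g (cone_imp A x y) = godel_imp n (g x) (g y)"
    if xy: "x \<in> B" "y \<in> B" for x y
  proof (cases "g x \<le> g y")
    case True
    then have "f \<preceq> cone_imp A x y" using g_le xy B_cone f by (simp add: le_cone_imp_iff)
    then have "f \<curlywedge> cone_imp A x y = f \<curlywedge> \<one>" using f by (simp add: rl_le_def cone_meet_one)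
    then show ?thesis
      using eqI[of "cone_imp A x y" \<one>] one xy B_cone True by (simp add: godel_imp_def)
  next
    case False
    obtain d d' where d: "d \<in> D" "d' \<in> D" and eq: "f \<curlywedge> x = f \<curlywedge> d" "f \<curlywedge> y = f \<curlywedge> d'"
      using B_cone(2)[OF xy(1)] B_cone(2)[OF xy(2)] unfolding C_def by blast
    \<comment> \<open>Here \<open>f \<curlywedge> d\<close> is not below \<open>d'\<close>. Were it
      below \<open>e\<close>, meeting with \<open>d\<close> once more would put it below
      \<open>d'\<close>. So comparing \<open>d\<close> with \<open>e\<close> leaves
      \<open>f \<curlywedge> e \<preceq> d\<close>, hence
      \<open>f \<curlywedge> e \<preceq> e \<curlywedge> d \<preceq> d'\<close>: below
      \<open>f\<close>, the residual \<open>e\<close> equals its second argument. For this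
      comparison \<open>f\<close> has to decide residuals too.\<close>
    define e where "e = cone_imp A d d'"
    have cone: "d \<in> cone A" "d' \<in> cone A" "e \<in> cone A" using d D_cone by (simp_all add: e_def)
    have "e \<in> case_prod (cone_imp A) ` (D \<times> D)" using d by (force simp: e_def)
    have "\<not> f \<curlywedge> d \<preceq> d'"
      using False g_le[of d d'] D_B d eq by (simp add: g_def)
    moreover have "f \<curlywedge> d \<preceq> d'" if "f \<curlywedge> d \<preceq> e"
    proof -
      have "(f \<curlywedge> d) \<curlywedge> d \<preceq> d'"
        using that cone f unfolding e_def by (simp add: le_cone_imp_iff)
      then show ?thesis using cone f by (simp add: meet_assoc meet_idem)
    qed
    ultimately have e_d: "f \<curlywedge> e \<preceq> d"
      using decisive[of d e] d \<open>e \<in> _ ` _\<close> by blast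
    have "e \<curlywedge> d \<preceq> d'" using le_cone_imp_iff[of e d d'] cone by (simp flip: e_def)
    moreover have "f \<curlywedge> e \<preceq> e \<curlywedge> d" using e_d cone f by (simp add: le_meet_iff)
    ultimately have "f \<curlywedge> e \<preceq> d'" using le_trans[of "f \<curlywedge> e" "e \<curlywedge> d" d'] cone f by simp
    moreover have "d' \<preceq> e" using cone le_cone_imp_iff[of d' d d'] by (simp add: e_def)
    then have "f \<curlywedge> d' \<preceq> e" using cone f by (simp add: meet_le_right)
    ultimately have "f \<curlywedge> e = f \<curlywedge> d'" using cone f by (intro le_antisym) (simp_all add: le_meet_iff)
    then have "f \<curlywedge> cone_imp A x y = f \<curlywedge> y"
      using cone_imp_cong_below[OF f, of x d y d'] eq B_cone xy cone by (simp add: e_def)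
    then show ?thesis
      using eqI[of "cone_imp A x y" y] xy B_cone False by (simp add: godel_imp_def)
  qed
  define S where "S = {x \<in> carrier A. coord1 A x \<in> B \<and> coord2 A x \<in> B}"
  define h where "h x = (g (coord1 A x), g (coord2 A x))" for x
  have S: "x \<in> carrier A" "coord1 A x \<in> B" "coord2 A x \<in> B" if "x \<in> S" for x
    using that by (simp_all add: S_def)
  have hom: "hom_on S A (K_full n) h"
    unfolding hom_on_def
    using one meet join imp
    by (simp add: S_def h_def K_full_simps coord1_one coord2_one coord1_join coord1_meet
        coord1_mult coord1_imp coord2_join coord2_meet coord2_mult coord2_imp subset_iff)
  have sub: "h ` S \<subseteq> carrier (K_full n)"
    unfolding h_def K_full_simps using S g_less by blast
  \<comment> \<open>The second coordinate of a cone element is the unit, so the elements of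
    \<open>D\<close> already cover the negative cone of the target.\<close>
  have cone: "(a, n - 1) \<in> h ` S" if a: "a < n" for a
  proof -
    have "a \<in> r ` C" using bij_betw_imp_surj_on[OF r] a by simp
    then obtain c where "c \<in> C" "r c = a" by blast
    then obtain d where d: "d \<in> D" "r (f \<curlywedge> d) = a" by (auto simp: C_def)
    then have "d \<in> S" "h d = (a, n - 1)"
      using D_cone[OF d(1)] D_B[OF d(1)] one by (simp_all add: S_def h_def coord_cone g_def)
    then show ?thesis by (metis imageI)
  qed
  have S_I: "x \<in> S" if "x \<in> carrier A" "coord1 A x \<in> D" "coord2 A x \<in> D" for x
    using that D_B by (simp add: S_def)
  have inj: "f \<curlywedge> coord1 A x = f \<curlywedge> coord1 A y \<and> f \<curlywedge> coord2 A x = f \<curlywedge> coord2 A y"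
    if "x \<in> S" "y \<in> S" "h x = h y" for x y
    using that(3) inj_onD[OF bij_betw_imp_inj_on[OF r]] B_cone S[OF that(1)] S[OF that(2)]
    by (simp add: h_def g_def)
  show ?thesis
    by (intro exI[of _ S] exI[of _ n] exI[of _ h] conjI allI ballI impI)
      (rule hom n sub cone S_I conjunct1[OF inj] conjunct2[OF inj]; assumption)+
qed

end

section \<open>From a failing identity to a finite generator\<close>

fun rl_vars :: "rl_term \<Rightarrow> nat set" where
  "rl_vars (RVar i) = {i}"
| "rl_vars ROne = {}"
| "rl_vars (RMult s t) = rl_vars s \<union> rl_vars t"
| "rl_vars (RJoin s t) = rl_vars s \<union> rl_vars t"
| "rl_vars (RMeet s t) = rl_vars s \<union> rl_vars t"
| "rl_vars (RImp s t) = rl_vars s \<union> rl_vars t"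

lemma finite_rl_vars: "finite (rl_vars t)"
  by (induction t) auto

lemma rl_eval_cong: "(\<And>i. i \<in> rl_vars t \<Longrightarrow> v i = w i) \<Longrightarrow> rl_eval A v t = rl_eval A w t"
  by (induction t) auto

lemma not_in_equational_theory:
  assumes "\<forall>i. v i \<in> carrier A" "rl_eval A v s \<noteq> rl_eval A v t"
  shows "(s, t) \<notin> equational_theory A"
  using assms by (auto simp: equational_theory_def satisfies_def)

text \<open>The generator found is a homomorphic image of a subalgebra of \<open>A\<close>, so it
  belongs to every variety that contains \<open>A\<close>.\<close>

lemma K_seq_separates:
  assumes A: "gnpcl A" and e: "e \<notin> equational_theory A"
  obtains m where "equational_theory A \<subseteq> equational_theory (K_seq m)" "e \<notin> equational_theory (K_seq m)"
proof -
  interpret gnpcl A by fact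
  obtain s t where st: "e = (s, t)" by fastforce
  obtain v where v: "\<forall>i. v i \<in> carrier A" "rl_eval A v s \<noteq> rl_eval A v t"
    using e st by (auto simp: equational_theory_def satisfies_def)
  define V where "V = rl_vars s \<union> rl_vars t"
  \<comment> \<open>The default value on variables that do not occur makes the range finite.\<close>
  define v' where "v' i = (if i \<in> V then v i else \<one>\<^bsub>A\<^esub>)" for i
  have v'_in: "\<forall>i. v' i \<in> carrier A" using v(1) by (simp add: v'_def)
  have "range v' \<subseteq> insert \<one>\<^bsub>A\<^esub> (v ` V)" by (auto simp: v'_def)
  moreover have "finite V" by (simp add: V_def finite_rl_vars)
  ultimately have fin: "finite (range v')" by (meson finite_imageI finite_insert finite_subset)
  define p where "p = rl_eval A v' s"
  define q where "q = rl_eval A v' t"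
  have "rl_eval A v' s = rl_eval A v s" "rl_eval A v' t = rl_eval A v t"
    by (rule rl_eval_cong, simp add: v'_def V_def)+
  then have "p \<noteq> q" using v(2) by (simp add: p_def q_def)
  have pq: "p \<in> carrier A" "q \<in> carrier A"
    unfolding p_def q_def using rl_eval_in_carrier[OF rl_algebra_axioms] v'_in by blast+
  have "coord1 A p \<noteq> coord1 A q \<or> coord2 A p \<noteq> coord2 A q"
    using coord_inject pq \<open>p \<noteq> q\<close> by blast
  then obtain c where c: "c = coord1 A \<or> c = coord2 A" and "c p \<noteq> c q" by blast
  have c_cone: "c p \<in> cone A" "c q \<in> cone A" using c pq by auto
  have "\<not> (c p \<preceq>\<^bsub>A\<^esub> c q \<and> c q \<preceq>\<^bsub>A\<^esub> c p)"
    using le_antisym[of "c p" "c q"] c_cone \<open>c p \<noteq> c q\<close> by auto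
  then obtain a b where ab: "(a, b) = (c p, c q) \<or> (a, b) = (c q, c p)" and not_le: "\<not> a \<preceq>\<^bsub>A\<^esub> b"
    by blast
  have ab_cone: "a \<in> cone A" "b \<in> cone A" using ab c_cone by auto
  \<comment> \<open>An \<open>f\<close> that is not below \<open>w\<close> satisfies
    \<open>f \<curlywedge> a \<preceq> b\<close> no more than the unit does, so \<open>a\<close> and
    \<open>b\<close> stay different modulo \<open>f\<close>.\<close>
  define w where "w = cone_imp A a b"
  have "\<one>\<^bsub>A\<^esub> \<curlywedge>\<^bsub>A\<^esub> a = a" using cone_meet_one[of a] meet_comm[of a "\<one>\<^bsub>A\<^esub>"] ab_cone by simp
  then have "\<not> \<one>\<^bsub>A\<^esub> \<preceq>\<^bsub>A\<^esub> w"
    using le_cone_imp_iff[of "\<one>\<^bsub>A\<^esub>" a b] ab_cone not_le by (simp add: w_def)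
  then have w: "w \<in> cone A" "w \<noteq> \<one>\<^bsub>A\<^esub>" using ab_cone by (auto simp: w_def)
  \<comment> \<open>Coordinates of the variables suffice: \<open>S\<close> is a subuniverse, so the
    values of all subterms follow.\<close>
  define D where "D = insert \<one>\<^bsub>A\<^esub> (coord1 A ` range v' \<union> coord2 A ` range v')"
  have D: "finite D" "D \<subseteq> cone A" "\<one>\<^bsub>A\<^esub> \<in> D" using fin v'_in by (auto simp: D_def)
  define D' where "D' = D \<union> case_prod (cone_imp A) ` (D \<times> D)"
  have "finite (D' \<times> D')" "D' \<times> D' \<subseteq> cone A \<times> cone A"
    using D by (auto simp: D'_def subset_iff)
  from decisive_element[OF this w] obtain f where f: "f \<in> cone A" "\<not> f \<preceq>\<^bsub>A\<^esub> w"
    and dec: "\<forall>(x, y)\<in>D' \<times> D'. f \<curlywedge>\<^bsub>A\<^esub> x \<preceq>\<^bsub>A\<^esub> y \<or> f \<curlywedge>\<^bsub>A\<^esub> y \<preceq>\<^bsub>A\<^esub> x" by blast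
  have dec': "\<forall>x\<in>D'. \<forall>y\<in>D'. f \<curlywedge>\<^bsub>A\<^esub> x \<preceq>\<^bsub>A\<^esub> y \<or> f \<curlywedge>\<^bsub>A\<^esub> y \<preceq>\<^bsub>A\<^esub> x" using dec by blast
  obtain S n h where
    h: "hom_on S A (K_full n) h" and n: "n \<ge> 1" and sub: "h ` S \<subseteq> carrier (K_full n)"
    and cone: "\<forall>a<n. (a, n - 1) \<in> h ` S"
    and S: "\<forall>x\<in>carrier A. coord1 A x \<in> D \<longrightarrow> coord2 A x \<in> D \<longrightarrow> x \<in> S"
    and inj: "\<forall>x\<in>S. \<forall>y\<in>S. h x = h y \<longrightarrow>
        f \<curlywedge>\<^bsub>A\<^esub> coord1 A x = f \<curlywedge>\<^bsub>A\<^esub> coord1 A y \<and> f \<curlywedge>\<^bsub>A\<^esub> coord2 A x = f \<curlywedge>\<^bsub>A\<^esub> coord2 A y"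
    using hom_to_K_full[OF D f(1) dec'[unfolded D'_def]] by (elim exE conjE)
  have v'_S: "\<forall>i. v' i \<in> S" using S v'_in by (simp add: D_def)
  have p: "p \<in> S" "h p = rl_eval (K_full n) (\<lambda>i. h (v' i)) s"
    and q: "q \<in> S" "h q = rl_eval (K_full n) (\<lambda>i. h (v' i)) t"
    using hom_on_eval[OF h v'_S] by (simp_all add: p_def q_def)
  have "h p \<noteq> h q"
  proof
    assume "h p = h q"
    then have "f \<curlywedge>\<^bsub>A\<^esub> c p = f \<curlywedge>\<^bsub>A\<^esub> c q" using inj p(1) q(1) c by blast
    then have "f \<curlywedge>\<^bsub>A\<^esub> a = f \<curlywedge>\<^bsub>A\<^esub> b" using ab by auto
    then have "f \<curlywedge>\<^bsub>A\<^esub> a \<preceq>\<^bsub>A\<^esub> b" using f ab_cone by simp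
    then show False using f(2) le_cone_imp_iff[of f a b] f(1) ab_cone by (simp add: w_def)
  qed
  then have fails: "rl_eval (K_full n) (\<lambda>i. h (v' i)) s \<noteq> rl_eval (K_full n) (\<lambda>i. h (v' i)) t"
    using p(2) q(2) by simp
  have closed: "x \<otimes>\<^bsub>K_full n\<^esub> y \<in> h ` S \<and> x \<curlywedge>\<^bsub>K_full n\<^esub> y \<in> h ` S \<and> x \<leadsto>\<^bsub>K_full n\<^esub> y \<in> h ` S"
    if xy: "x \<in> h ` S" "y \<in> h ` S" for x y
  proof -
    obtain x' y' where "x' \<in> S" "x = h x'" "y' \<in> S" "y = h y'" using xy by blast
    then show ?thesis using h unfolding hom_on_def by (metis imageI)
  qed
  have large: "carrier (K_full n) - {(0, 0)} \<subseteq> h ` S"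
    by (rule closed_subset_K_full[OF closed cone[rule_format]])
  have v'_image: "\<forall>i. h (v' i) \<in> h ` S" using v'_S by blast
  show thesis
  proof (cases "(0, 0) \<in> h ` S")
    case True
    obtain j where j: "n = Suc j" using n by (cases n) auto
    have K: "K_seq (2 * j) = K_full n" by (simp add: K_seq_even j)
    have "equational_theory A \<subseteq> equational_theory (K_full n)"
      using True large by (intro equational_theory_image[OF h]) blast
    moreover have "e \<notin> equational_theory (K_full n)"
      unfolding st using fails v'_image sub by (intro not_in_equational_theory[where v = "\<lambda>i. h (v' i)"]) auto
    ultimately show thesis using that[of "2 * j"] K by simp
  next
    case False
    \<comment> \<open>For \<open>n = 1\<close> the unit itself is \<open>(0, 0)\<close>.\<close>
    then have "n \<noteq> 1" using cone by auto
    then have "n = Suc (Suc (n - 2))" using n by simp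
    then obtain j where j: "n = Suc (Suc j)" by blast
    have K: "K_seq (Suc (2 * j)) = K_punctured n" by (simp add: K_seq_odd j)
    have h': "hom_on S A (K_punctured n) h" using h by (simp add: hom_on_def K_punctured_simps)
    have carr: "carrier (K_punctured n) = h ` S"
      using False large sub unfolding K_punctured_simps(1) K_full_simps(1) by blast
    have "equational_theory A \<subseteq> equational_theory (K_punctured n)"
      using carr by (intro equational_theory_image[OF h']) simp
    moreover have "e \<notin> equational_theory (K_punctured n)"
      unfolding st using fails v'_image carr
      by (intro not_in_equational_theory[where v = "\<lambda>i. h (v' i)"])
        (simp_all add: rl_eval_punctured)
    ultimately show thesis using that[of "Suc (2 * j)"] K by simp
  qed
qed

section \<open>The lattice of subvarieties\<close>

lemma ex_copy_alg:
  assumes inf: "infinite (UNIV :: 'a set)" and "rl_algebra B" "finite (carrier B)"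
  shows "\<exists>C :: 'a rl_alg. rl_algebra C \<and> equational_theory C = equational_theory B \<and>
    card (carrier C) = card (carrier B)"
proof -
  obtain X :: "'a set" where "finite X" "card X = card (carrier B)"
    using infinite_arbitrarily_large[OF inf] by metis
  then obtain f where "bij_betw f (carrier B) X"
    using assms(3) finite_same_card_bij by metis
  then have f: "inj_on f (carrier B)" by (rule bij_betw_imp_inj_on)
  show ?thesis
    using copy_alg[OF assms(2) f] card_image[OF f] by (intro exI[of _ "copy_alg f B"]) simp
qed

text \<open>The generator lives on another type than the members of its variety; a copy of it on the
  infinite type witnesses the forward direction.\<close>

lemma generated_K_seq_subset_iff:
  assumes "infinite (UNIV :: 'a set)"
  shows "(generated_variety (K_seq m) :: 'a rl_alg set) \<subseteq> Models E \<longleftrightarrow> E \<subseteq> equational_theory (K_seq m)"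
proof
  assume sub: "(generated_variety (K_seq m) :: 'a rl_alg set) \<subseteq> Models E"
  obtain C :: "'a rl_alg" where "rl_algebra C" "equational_theory C = equational_theory (K_seq m)"
    using ex_copy_alg[OF assms rl_algebra_K_seq finite_K_seq] by blast
  then show "E \<subseteq> equational_theory (K_seq m)"
    using sub by (auto simp: generated_variety_eq[OF rl_algebra_K_seq] Models_iff subset_iff)
next
  assume "E \<subseteq> equational_theory (K_seq m)"
  then show "(generated_variety (K_seq m) :: 'a rl_alg set) \<subseteq> Models E"
    unfolding generated_variety_eq[OF rl_algebra_K_seq] Models_def equational_theory_def by blast
qed

lemma generated_K_seq_mono_iff:
  assumes "infinite (UNIV :: 'a set)"
  shows "(generated_variety (K_seq m) :: 'a rl_alg set) \<subseteq> generated_variety (K_seq m') \<longleftrightarrow> m \<le> m'"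
  using generated_K_seq_subset_iff[OF assms, of m "equational_theory (K_seq m')"]
  by (simp add: generated_variety_eq[OF rl_algebra_K_seq] equational_theory_K_seq_iff)

lemma generated_K_seq_subset_GNPcL:
  "(generated_variety (K_seq m) :: 'a rl_alg set) \<subseteq> GNPcL"
  using GNPcL_basis_K_seq[of m]
  unfolding generated_variety_eq[OF rl_algebra_K_seq] GNPcL_eq_Models Models_def
    equational_theory_def by blast

text \<open>The next generator already yields a strictly larger variety inside GNPcL.\<close>

lemma GNPcL_not_subset_generated:
  assumes "infinite (UNIV :: 'a set)"
  shows "\<not> (GNPcL :: 'a rl_alg set) \<subseteq> generated_variety (K_seq m)"
  using generated_K_seq_subset_GNPcL[of "Suc m", where 'a = 'a]
    generated_K_seq_mono_iff[OF assms, of "Suc m" m] by auto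

lemma equational_theory_K_seq_0: "equational_theory (K_seq 0) = UNIV"
proof -
  have c: "carrier (K_seq 0) = {(0, 0)}"
    using K_seq_even[of 0] by (auto simp: K_full_simps)
  have "satisfies (K_seq 0) e" for e
    using rl_eval_in_carrier[OF rl_algebra_K_seq, of _ 0] unfolding satisfies_def c by simp
  then show ?thesis by (simp add: equational_theory_def)
qed

text \<open>\<open>M\<close> is the initial segment of indices whose generators satisfy
  \<open>E\<close>. If it is infinite, it is everything, so no identity of \<open>E\<close> can fail
  in GNPcL. Otherwise its maximum \<open>k\<close> generates \<open>W\<close>: an identity that
  fails in a member of \<open>W\<close> fails at some index in \<open>M\<close>, hence also at
  \<open>k\<close>.\<close>

lemma subvariety_cases:
  fixes W :: "'a rl_alg set"
  assumes W: "W \<in> subvarieties GNPcL"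
  shows "W = GNPcL \<or> (\<exists>m. W = generated_variety (K_seq m))"
proof -
  obtain E where E: "W = Models E" and sub: "W \<subseteq> GNPcL"
    using W by (auto simp: subvarieties_def is_variety_def)
  define M where "M = {m. E \<subseteq> equational_theory (K_seq m)}"
  have separate: "\<exists>m\<in>M. e \<notin> equational_theory (K_seq m)"
    if A: "A \<in> W" "e \<notin> equational_theory A" for A e
  proof -
    obtain m where "equational_theory A \<subseteq> equational_theory (K_seq m)"
      "e \<notin> equational_theory (K_seq m)"
      using K_seq_separates[of A e] A sub by (auto simp: GNPcL_def)
    then show ?thesis using A(1) by (auto simp: M_def E Models_iff)
  qed
  have down: "m \<in> M" if "m' \<in> M" "m \<le> m'" for m m'
    using that equational_theory_K_seq_iff[of m' m] unfolding M_def by blast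
  show ?thesis
  proof (cases "finite M")
    case False
    have all: "m \<in> M" for m
    proof -
      obtain m' where "m' \<in> M" "m < m'" using False infinite_nat_iff_unbounded by blast
      then show ?thesis using down by simp
    qed
    have "A \<in> W" if A: "A \<in> GNPcL" for A
    proof (rule ccontr)
      assume "A \<notin> W"
      moreover have "rl_algebra A" using A by (simp add: GNPcL_eq_Models Models_iff)
      ultimately obtain e where "e \<in> E" "e \<notin> equational_theory A" by (auto simp: E Models_iff)
      moreover obtain m where "e \<notin> equational_theory (K_seq m)"
        using K_seq_separates[of A e] A \<open>e \<notin> _\<close> by (auto simp: GNPcL_def)
      ultimately show False using all[of m] unfolding M_def by blast
    qed
    then show ?thesis using sub by blast
  next
    case True
    \<comment> \<open>The trivial algebra satisfies every identity, so the maximum is taken over a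
      nonempty set.\<close>
    have "0 \<in> M" by (simp add: M_def equational_theory_K_seq_0)
    define k where "k = Max M"
    have k: "k \<in> M" and le: "\<And>m. m \<in> M \<Longrightarrow> m \<le> k"
      using True \<open>0 \<in> M\<close> by (auto simp: k_def intro: Max_in)
    have "A \<in> generated_variety (K_seq k)" if A: "A \<in> W" for A
    proof -
      have "equational_theory (K_seq k) \<subseteq> equational_theory A"
        using separate[OF A] le equational_theory_K_seq_iff by blast
      moreover have "rl_algebra A" using A by (simp add: E Models_iff)
      ultimately show ?thesis by (simp add: generated_variety_eq[OF rl_algebra_K_seq] Models_iff)
    qed
    moreover have "generated_variety (K_seq k) \<subseteq> W"
      using k unfolding generated_variety_eq[OF rl_algebra_K_seq] E M_def Models_def
        equational_theory_def by blast
    ultimately show ?thesis by blast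
  qed
qed

lemma subvarieties_GNPcL:
  "subvarieties (GNPcL :: 'a rl_alg set) = insert GNPcL (range (\<lambda>m. generated_variety (K_seq m)))"
proof
  show "subvarieties GNPcL \<subseteq> insert GNPcL (range (\<lambda>m. generated_variety (K_seq m)))"
    using subvariety_cases by fastforce
  have "is_variety (GNPcL :: 'a rl_alg set)"
    using GNPcL_eq_Models unfolding is_variety_def by blast
  moreover have "is_variety (generated_variety (K_seq m) :: 'a rl_alg set)" for m
    using generated_variety_eq[OF rl_algebra_K_seq] unfolding is_variety_def by blast
  ultimately show "insert GNPcL (range (\<lambda>m. generated_variety (K_seq m)))
      \<subseteq> subvarieties (GNPcL :: 'a rl_alg set)"
    using generated_K_seq_subset_GNPcL unfolding subvarieties_def by blast
qed

lemma nontrivial_generated_K_seq_iff: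
  assumes "infinite (UNIV :: 'a set)"
  shows "nontrivial_variety (generated_variety (K_seq m) :: 'a rl_alg set) \<longleftrightarrow> m \<ge> 1"
proof
  have trivial: "\<not> nontrivial_variety (generated_variety (K_seq 0) :: 'a rl_alg set)"
  proof
    assume "nontrivial_variety (generated_variety (K_seq 0) :: 'a rl_alg set)"
    then obtain A :: "'a rl_alg" and x y where A: "A \<in> generated_variety (K_seq 0)"
      and xy: "x \<in> carrier A" "y \<in> carrier A" "x \<noteq> y"
      by (auto simp: nontrivial_variety_def)
    have "satisfies A (RVar 0, RVar 1)"
      using A by (simp add: generated_variety_eq[OF rl_algebra_K_seq] Models_def equational_theory_K_seq_0)
    then show False
      using xy satisfies_three[of A "(RVar 0, RVar 1)" x y y] by simp
  qed
  then show "nontrivial_variety (generated_variety (K_seq m) :: 'a rl_alg set) \<Longrightarrow> m \<ge> 1"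
    by (cases m) auto
next
  assume "m \<ge> 1"
  obtain C :: "'a rl_alg" where C: "rl_algebra C" "equational_theory C = equational_theory (K_seq m)"
    "card (carrier C) = index_seq m"
    using ex_copy_alg[OF assms rl_algebra_K_seq finite_K_seq] card_K_seq by metis
  have "C \<in> generated_variety (K_seq m)"
    using C by (simp add: generated_variety_eq[OF rl_algebra_K_seq] Models_iff)
  moreover have "card (carrier C) > 1"
    using C(3) \<open>m \<ge> 1\<close> index_seq_pos[of 0] strict_monoD[OF index_seq_strict_mono, of 0 m] by simp
  then have "\<exists>x\<in>carrier C. \<exists>y\<in>carrier C. x \<noteq> y"
    using card_le_Suc0_iff_eq[OF card_ge_0_finite, of "carrier C"] by fastforce
  ultimately show "nontrivial_variety (generated_variety (K_seq m) :: 'a rl_alg set)"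
    unfolding nontrivial_variety_def by blast
qed

section \<open>The order type of the lattice\<close>

lemma Well_order_relation_of_le: "Well_order (relation_of (\<le>) (UNIV :: 'b :: wellorder set))"
proof -
  let ?r = "relation_of (\<le>) (UNIV :: 'b set)"
  have r: "?r = {(x, y). x \<le> y}" by (auto simp: relation_of_def)
  have "Field ?r = UNIV" by (auto simp: r Field_def)
  moreover have "?r - Id = {(x, y). x < y}" by (auto simp: r)
  ultimately show ?thesis
    using wf[where 'a = 'b]
    by (auto simp: well_order_on_def linear_order_on_def partial_order_on_def preorder_on_def r
        refl_on_def trans_def antisym_def total_on_def)
qed

text \<open>\<open>ordIso\<close> relates well-orders only, so the order is transported from the
  index type along the injection \<open>F\<close>.\<close>

lemma relation_of_image_ordIso:
  fixes F :: "'b :: wellorder \<Rightarrow> 'c set"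
  assumes "\<And>x y. F x \<subseteq> F y \<longleftrightarrow> x \<le> y"
  shows "(relation_of (\<subseteq>) (range F), relation_of (\<le>) (UNIV :: 'b set)) \<in> ordIso"
proof -
  let ?r = "relation_of (\<le>) (UNIV :: 'b set)"
  have "inj F" using assms by (metis antisym injI order_refl)
  then have "(?r, dir_image ?r F) \<in> ordIso"
    by (intro dir_image_ordIso Well_order_relation_of_le) (auto simp: inj_on_def)
  moreover have "dir_image ?r F = relation_of (\<subseteq>) (range F)"
    using assms by (auto simp: dir_image_def relation_of_def)
  ultimately show ?thesis using ordIso_symmetric by simp
qed

theorem corollary6p6:
  assumes "infinite (UNIV :: 'a set)"
  shows "(relation_of (\<subseteq>) (subvarieties (GNPcL :: 'a rl_alg set)),
           relation_of (\<le>) (UNIV :: enat set)) \<in> ordIso \<and>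
         {V \<in> subvarieties (GNPcL :: 'a rl_alg set). V \<noteq> GNPcL \<and> nontrivial_variety V}
           = {generated_variety (K_alg (n\<^sup>2)) | n. n \<ge> 2}
             \<union> {generated_variety (K_alg (n\<^sup>2 - 1)) | n. n \<ge> 2} \<and>
         (\<forall>u \<in> K_indices. \<forall>v \<in> K_indices.
           (generated_variety (K_alg u) :: 'a rl_alg set) \<subseteq> generated_variety (K_alg v)
             \<longleftrightarrow> u \<le> v)"
proof (intro conjI ballI)
  let ?V = "\<lambda>u. generated_variety (K_alg u) :: 'a rl_alg set"
  \<comment> \<open>\<open>enat\<close> has order type omega+1: 0 goes to the trivial variety and
    the limit to GNPcL.\<close>
  define F where "F x = (case x of enat m \<Rightarrow> ?V (index_seq m) | \<infinity> \<Rightarrow> GNPcL)" for x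
  have "F x \<subseteq> F y \<longleftrightarrow> x \<le> y" for x y
    using generated_K_seq_mono_iff[OF assms] generated_K_seq_subset_GNPcL[where 'a = 'a]
      GNPcL_not_subset_generated[OF assms]
    by (simp add: F_def split: enat.split)
  moreover have "range F = subvarieties GNPcL"
  proof -
    have "(UNIV :: enat set) = insert \<infinity> (range enat)" by (auto intro: enat.exhaust)
    then have "range F = F ` insert \<infinity> (range enat)" by (rule arg_cong)
    then show ?thesis by (simp add: subvarieties_GNPcL F_def image_image)
  qed
  ultimately show "(relation_of (\<subseteq>) (subvarieties (GNPcL :: 'a rl_alg set)),
      relation_of (\<le>) (UNIV :: enat set)) \<in> ordIso"
    using relation_of_image_ordIso[of F] by simp
  have "?V (index_seq m) \<noteq> GNPcL" for m using GNPcL_not_subset_generated[OF assms] by blast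
  then have "{V \<in> subvarieties (GNPcL :: 'a rl_alg set). V \<noteq> GNPcL \<and> nontrivial_variety V}
      = ?V ` {index_seq m | m. m \<ge> 1}"
    unfolding subvarieties_GNPcL using nontrivial_generated_K_seq_iff[OF assms] by blast
  also have "\<dots> = ?V ` ({n\<^sup>2 | n. n \<ge> 2} \<union> {n\<^sup>2 - 1 | n. n \<ge> 2})"
    unfolding K_indices_eq[symmetric] K_indices_def ..
  also have "\<dots> = {?V (n\<^sup>2) | n. n \<ge> 2} \<union> {?V (n\<^sup>2 - 1) | n. n \<ge> 2}" by blast
  finally show "{V \<in> subvarieties (GNPcL :: 'a rl_alg set). V \<noteq> GNPcL \<and> nontrivial_variety V}
      = {?V (n\<^sup>2) | n. n \<ge> 2} \<union> {?V (n\<^sup>2 - 1) | n. n \<ge> 2}" .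
next
  fix u v assume "u \<in> K_indices" "v \<in> K_indices"
  then show "(generated_variety (K_alg u) :: 'a rl_alg set) \<subseteq> generated_variety (K_alg v)
      \<longleftrightarrow> u \<le> v"
    using generated_K_seq_mono_iff[OF assms] strict_mono_less_eq[OF index_seq_strict_mono]
    unfolding K_indices_eq by auto
qed

end
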